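(* Let $G$ be a finite additive abelian group with $|G| > 1$. Let $h$ and $m$ be positive integers with $2 \leq h \leq m$. Let $A$ be a nonempty finite subset of $G$ with $|A| = m$. Then $$|[0, h]_{\pm}^\wedge A| \geq \begin{cases} \min (p(G), 2hm - h^2 - h|A \cap (- A)| + 1), & \text{if } 0 \in A;\\ \min (p(G), 2hm - h^2 - h|A \cap (- A)| + h + 1), & \text{if } 0 \not\in A. \end{cases}$$
   Context: For a finite subset $A=\{a_1,\dots,a_m\}$ (with $|A|=m$) of $G$ and a nonnegative integer $j$, the restricted $j$-fold signed sumset is $j_{\pm}^{\wedge}A=\{\sum_{i=1}^m\lambda_i a_i:\lambda_i\in\{-1,0,1\},\ \sum_{i=1}^m|\lambda_i|=j\}$, with $0_{\pm}^{\wedge}A=\{0\}$, and $[0,h]_{\pm}^{\wedge}A=\bigcup_{j=0}^{h}j_{\pm}^{\wedge}A$. Write $-A=\{-a:a\in A\}$. $p(G)$ denotes the order of the smallest nontrivial subgroup of $G$ (for finite $G$, the smallest prime divisor of $|G|$). *)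

theory Defs
  imports Main "HOL-Library.Cardinality"
begin

definition add_subgroup :: "'a::ab_group_add set \<Rightarrow> bool" where
  "add_subgroup H \<longleftrightarrow> 0 \<in> H \<and> (\<forall>x\<in>H. \<forall>y\<in>H. x + y \<in> H) \<and> (\<forall>x\<in>H. - x \<in> H)"

text \<open>
  The order of the smallest nontrivial subgroup; the whole group is among the candidates, so
  the minimum is over a nonempty set as soon as the group has more than one element.
\<close>

definition min_subgroup_order :: "'a::{finite, ab_group_add} itself \<Rightarrow> nat" where
  "min_subgroup_order _ = Min {card H |H :: 'a set. add_subgroup H \<and> H \<noteq> {0}}"

text \<open>The integer multiple \<open>k \<cdot> a\<close>; at most one of the two sums is nonempty.\<close>

definition int_multiple :: "int \<Rightarrow> 'a::ab_group_add \<Rightarrow> 'a" where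
  "int_multiple k a = (\<Sum>i<nat k. a) - (\<Sum>i<nat (- k). a)"

text \<open>Coefficients are indexed by the elements of the (finite) set \<open>A\<close> itself.\<close>

definition restricted_signed_sumset :: "nat \<Rightarrow> 'a::ab_group_add set \<Rightarrow> 'a set" where
  "restricted_signed_sumset j A =
    {\<Sum>a\<in>A. int_multiple (l a) a |l :: 'a \<Rightarrow> int.
      (\<forall>a\<in>A. l a \<in> {-1, 0, 1}) \<and> (\<Sum>a\<in>A. \<bar>l a\<bar>) = int j}"

definition restricted_signed_sumset_upto :: "nat \<Rightarrow> 'a::ab_group_add set \<Rightarrow> 'a set" where
  "restricted_signed_sumset_upto h A = (\<Union>j\<in>{0..h}. restricted_signed_sumset j A)"

lemma int_multiple_simps [simp]:
  "int_multiple 0 a = 0" "int_multiple 1 a = a" "int_multiple (- 1) a = - a"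
  by (simp_all add: int_multiple_def)

lemma restricted_signed_sumset_0:
  assumes "finite A"
  shows "restricted_signed_sumset 0 A = {0}"
proof -
  have "(\<Sum>a\<in>A. int_multiple (l a) a) = 0" if "(\<Sum>a\<in>A. \<bar>l a\<bar>) = 0" for l :: "'a \<Rightarrow> int"
    using that assms by (simp add: sum_nonneg_eq_0_iff)
  moreover have "\<exists>l :: 'a \<Rightarrow> int. (\<forall>a\<in>A. l a \<in> {-1, 0, 1}) \<and> (\<Sum>a\<in>A. \<bar>l a\<bar>) = 0"
    by (rule exI[of _ "\<lambda>_. 0"]) simp
  ultimately show ?thesis
    unfolding restricted_signed_sumset_def by force
qed

end

theory Submission
  imports Defs "HOL-Library.Set_Algebras" "HOL-Number_Theory.Cong"
    "HOL-Computational_Algebra.Polynomial" "Jordan_Normal_Form.Determinant"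
begin

text \<open>
  Put \<open>B = {0} \<union> A \<union> -A\<close>. A sum of \<open>h\<close> distinct elements of \<open>B\<close> is a signed sum of at most \<open>h\<close>
  elements of \<open>A\<close>, and \<open>|B|\<close> is \<open>2m - |A \<inter> -A|\<close>, plus one if \<open>0\<close> is not in \<open>A\<close>. So the
  bound is the Dias da Silva--Hamidoune inequality
  \<open>|h^B| \<ge> min(p(G), h(|B| - h) + 1)\<close> for an arbitrary finite abelian group.

  That inequality is proved by induction on subgroups. Let \<open>K\<close> be a maximal proper subgroup, of
  prime index \<open>q \<ge> p(G)\<close>, and let \<open>k_x\<close> be the number of elements of \<open>B\<close> over the residue \<open>x\<close>.
  Choosing \<open>\<eta>_x\<close> elements over each \<open>x\<close> gives, by induction and Cauchy--Davenport, at least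
  \<open>1 + \<Sum> \<eta>_x (k_x - \<eta>_x)\<close> sums in the coset \<open>\<Sum> \<eta>_x x\<close>. Starting from a balanced \<open>\<rho>\<close>, whose
  spread \<open>\<Sum> \<rho>_x (k_x - \<rho>_x)\<close> Chebyshev's sum inequality bounds from below, one adds the indicator
  of a set of \<open>g\<close> residues; the number of cosets reached in this way is controlled by the
  Alon--Nathanson--Ruzsa theorem modulo \<open>q\<close>.
\<close>

section \<open>The polynomial method modulo a prime\<close>

text \<open>These are the weights of the divided difference at \<open>x 0, ..., x c\<close>.
  Appending a node divides the old weights by their distance to it.\<close>

lemma divided_difference_weights:
  fixes x :: "nat \<Rightarrow> int" and q :: int
  assumes "prime q" and "\<And>i j. i < j \<Longrightarrow> j \<le> c \<Longrightarrow> \<not> [x i = x j] (mod q)"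
  shows "\<exists>u. \<forall>i\<le>c. [(\<Sum>j\<le>c. u j * x j ^ i) = (if i = c then 1 else 0)] (mod q)"
  using assms(2)
proof (induction c)
  case 0
  show ?case by (rule exI[of _ "\<lambda>_. 1"]) simp
next
  case (Suc c)
  then obtain u where u: "\<And>i. i \<le> c \<Longrightarrow> [(\<Sum>j\<le>c. u j * x j ^ i) = (if i = c then 1 else 0)] (mod q)"
    using Suc.IH Suc.prems by (meson le_SucI)
  have "\<exists>v. [(x j - x (Suc c)) * v = 1] (mod q)" if "j \<le> c" for j
  proof -
    have "\<not> q dvd x j - x (Suc c)"
      using Suc.prems[of j "Suc c"] that by (simp add: cong_iff_dvd_diff)
    then have "coprime (x j - x (Suc c)) q"
      using assms(1) by (metis coprime_commute prime_imp_coprime)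
    then show ?thesis by (rule cong_solve_coprime_int)
  qed
  then obtain v where v: "\<And>j. j \<le> c \<Longrightarrow> [(x j - x (Suc c)) * v j = 1] (mod q)"
    by metis
  \<comment> \<open>The last weight is chosen so that the zeroth moment vanishes; the recurrence
    \<open>step\<close> then determines the other moments.\<close>
  define w where "w j = (if j \<le> c then u j * v j else - (\<Sum>i\<le>c. u i * v i))" for j
  define M where "M i = (\<Sum>j\<le>Suc c. w j * x j ^ i)" for i
  have M0: "M 0 = 0"
    by (simp add: M_def w_def)
  have step: "[M (Suc i) = x (Suc c) * M i + (if i = c then 1 else 0)] (mod q)" if "i \<le> c" for i
  proof -
    have "M (Suc i) - x (Suc c) * M i = (\<Sum>j\<le>Suc c. w j * x j ^ i * (x j - x (Suc c)))"
      unfolding M_def sum_distrib_left sum_subtractf [symmetric]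
      by (rule sum.cong) (auto simp: algebra_simps)
    also have "\<dots> = (\<Sum>j\<le>c. u j * x j ^ i * ((x j - x (Suc c)) * v j))"
      by (simp add: w_def mult_ac)
    also have "[\<dots> = (\<Sum>j\<le>c. u j * x j ^ i * 1)] (mod q)"
      by (intro cong_sum cong_mult cong_refl v) simp
    also have "[(\<Sum>j\<le>c. u j * x j ^ i * 1) = (if i = c then 1 else 0)] (mod q)"
      using u[OF that] by simp
    finally have "[x (Suc c) * M i + (M (Suc i) - x (Suc c) * M i) = x (Suc c) * M i + (if i = c then 1 else 0)] (mod q)"
      by (intro cong_add cong_refl)
    then show ?thesis by simp
  qed
  have M: "i \<le> c \<Longrightarrow> [M i = 0] (mod q)" for i
  proof (induction i)
    case (Suc i)
    have "[M (Suc i) = x (Suc c) * M i + 0] (mod q)"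
      using step[of i] Suc.prems by simp
    also have "[x (Suc c) * M i + 0 = x (Suc c) * 0 + 0] (mod q)"
      using Suc by (intro cong_add cong_mult cong_refl) simp
    finally show ?case by simp
  qed (simp add: M0)
  have "[M (Suc c) = x (Suc c) * M c + 1] (mod q)"
    using step[of c] by simp
  also have "[x (Suc c) * M c + 1 = x (Suc c) * 0 + 1] (mod q)"
    by (intro cong_add cong_mult cong_refl M) simp
  finally have "[M (Suc c) = 1] (mod q)" by simp
  with M show ?case
    by (intro exI[of _ w]) (auto simp: M_def le_Suc_eq)
qed

section \<open>Moments over a grid and the Combinatorial Nullstellensatz\<close>

definition falling :: "int \<Rightarrow> nat \<Rightarrow> int" where
  "falling z s = (\<Prod>i<s. z - int i)"

lemma falling_eq_0: "c < s \<Longrightarrow> falling (int c) s = 0"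
  by (auto simp: falling_def)

lemma falling_self: "falling (int c) c = fact c"
proof (induction c)
  case (Suc c)
  have "falling (int (Suc c)) (Suc c) = (\<Prod>i\<in>{..<Suc c}. int (Suc c - i))"
    unfolding falling_def by (rule prod.cong) auto
  also have "\<dots> = int (Suc c) * (\<Prod>i<c. int (c - i))"
    by (subst prod.lessThan_Suc_shift) simp
  also have "(\<Prod>i<c. int (c - i)) = falling (int c) c"
    unfolding falling_def by (rule prod.cong) auto
  finally show ?case using Suc by simp
qed (simp add: falling_def)

text \<open>
  If every \<open>u l\<close> is a family of divided difference weights, the weighted sum picks out the
  coefficient of \<open>\<Prod>x\<^sub>l ^ c l\<close> in \<open>(\<Sum>x\<^sub>l) ^ t * \<Prod>x\<^sub>l ^ s l\<close>, which is how the
  Combinatorial Nullstellensatz is expressed here without multivariate polynomials.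
\<close>

definition moment :: "nat \<Rightarrow> (nat \<Rightarrow> nat) \<Rightarrow> (nat \<Rightarrow> nat \<Rightarrow> int) \<Rightarrow> (nat \<Rightarrow> nat \<Rightarrow> int)
    \<Rightarrow> nat \<Rightarrow> (nat \<Rightarrow> nat) \<Rightarrow> int" where
  "moment g c X u t s = (\<Sum>j\<in>PiE {..<g} (\<lambda>l. {..c l}).
     (\<Sum>l<g. X l (j l)) ^ t * (\<Prod>l<g. u l (j l) * X l (j l) ^ s l))"

text \<open>One factor of the power of the sum is expanded; its summand \<open>X k (j k)\<close>
  raises the exponent \<open>s k\<close> by one.\<close>

lemma moment_Suc:
  "moment g c X u (Suc t) s = (\<Sum>k<g. moment g c X u t (s(k := Suc (s k))))"
proof -
  have "(\<Sum>l<g. X l (j l)) ^ Suc t * (\<Prod>l<g. u l (j l) * X l (j l) ^ s l)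
    = (\<Sum>k<g. (\<Sum>l<g. X l (j l)) ^ t * (\<Prod>l<g. u l (j l) * X l (j l) ^ (s(k := Suc (s k))) l))" for j
  proof -
    have "(\<Prod>l<g. u l (j l) * X l (j l) ^ (s(k := Suc (s k))) l)
      = X k (j k) * (\<Prod>l<g. u l (j l) * X l (j l) ^ s l)" if "k < g" for k
    proof -
      have "(\<Prod>l<g. u l (j l) * X l (j l) ^ (s(k := Suc (s k))) l)
        = (u k (j k) * X k (j k) ^ Suc (s k)) * (\<Prod>l\<in>{..<g}-{k}. u l (j l) * X l (j l) ^ (s(k := Suc (s k))) l)"
        using that by (subst prod.remove[of _ k]) auto
      also have "(\<Prod>l\<in>{..<g}-{k}. u l (j l) * X l (j l) ^ (s(k := Suc (s k))) l)
        = (\<Prod>l\<in>{..<g}-{k}. u l (j l) * X l (j l) ^ s l)"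
        by (rule prod.cong) auto
      also have "(u k (j k) * X k (j k) ^ Suc (s k)) * \<dots>
        = X k (j k) * ((u k (j k) * X k (j k) ^ s k) * \<dots>)"
        by simp
      also have "(u k (j k) * X k (j k) ^ s k) * (\<Prod>l\<in>{..<g}-{k}. u l (j l) * X l (j l) ^ s l)
        = (\<Prod>l<g. u l (j l) * X l (j l) ^ s l)"
        using that by (subst prod.remove[of _ k]) auto
      finally show ?thesis .
    qed
    then show ?thesis
      by (simp add: sum_distrib_left sum_distrib_right mult_ac)
  qed
  then show ?thesis
    unfolding moment_def by (simp add: sum.swap[of _ "{..<g}"])
qed

text \<open>
  The coefficient is \<open>t! / \<Prod>(c l - s l)!\<close>; multiplying by \<open>\<Prod>(c l)!\<close> clears denominators and
  covers the case \<open>s l > c l\<close>, where \<open>falling\<close> vanishes.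
\<close>

lemma moment_cong:
  fixes q :: int
  assumes u: "\<And>l i. l < g \<Longrightarrow> i \<le> c l \<Longrightarrow>
      [(\<Sum>j\<le>c l. u l j * X l j ^ i) = (if i = c l then 1 else 0)] (mod q)"
    and "t + (\<Sum>l<g. s l) \<le> (\<Sum>l<g. c l)"
  shows "[moment g c X u t s * (\<Prod>l<g. fact (c l))
    = (if t + (\<Sum>l<g. s l) = (\<Sum>l<g. c l) then fact t * (\<Prod>l<g. falling (int (c l)) (s l)) else 0)] (mod q)"
  using assms(2)
proof (induction t arbitrary: s)
  case 0
  have eq: "moment g c X u 0 s = (\<Prod>l<g. \<Sum>a\<le>c l. u l a * X l a ^ s l)"
    unfolding moment_def by (subst prod_sum_PiE) auto
  show ?case
  \<comment> \<open>For \<open>t = 0\<close> the moment is a product over coordinates. A coordinate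
    with \<open>s k < c k\<close> makes it vanish; if the degrees still balance, another one has
    \<open>c l < s l\<close>, which kills the right-hand side too.\<close>
  proof (cases "\<exists>k<g. s k < c k")
    case True
    then obtain k where k: "k < g" "s k < c k" by blast
    have "[(\<Sum>a\<le>c k. u k a * X k a ^ s k) = 0] (mod q)"
      using u[of k "s k"] k by simp
    then have "q dvd moment g c X u 0 s"
      unfolding eq cong_0_iff using k by (meson dvd_prodI dvd_trans finite_lessThan lessThan_iff)
    moreover have "(\<Prod>l<g. falling (int (c l)) (s l)) = 0" if "(\<Sum>l<g. s l) = (\<Sum>l<g. c l)"
    proof -
      have "\<exists>l<g. c l < s l"
      proof (rule ccontr)
        assume "\<not> (\<exists>l<g. c l < s l)"
        then have "\<And>l. l < g \<Longrightarrow> s l \<le> c l" by (meson not_le)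
        then have "(\<Sum>l<g. s l) < (\<Sum>l<g. c l)"
          using k by (intro sum_strict_mono_ex1) (auto simp: not_less intro: leI)
        then show False using that by simp
      qed
      then show ?thesis using falling_eq_0 by (auto intro!: prod_zero)
    qed
    ultimately show ?thesis by (simp add: cong_0_iff del: prod_zero_iff)
  next
    case False
    then have le: "c l \<le> s l" if "l < g" for l using that by (meson not_le)
    have all: "s l = c l" if "l < g" for l
    proof (rule ccontr)
      assume "s l \<noteq> c l"
      then have "(\<Sum>l<g. c l) < (\<Sum>l<g. s l)"
        using le that by (intro sum_strict_mono_ex1) (auto simp: order_less_le intro!: bexI[of _ l])
      then show False using 0 by simp
    qed
    have "[moment g c X u 0 s = (\<Prod>l<g. 1)] (mod q)"
      unfolding eq by (intro cong_prod) (use u all in fastforce)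
    then have "[moment g c X u 0 s * (\<Prod>l<g. fact (c l)) = (\<Prod>l<g. 1) * (\<Prod>l<g. fact (c l))] (mod q)"
      by (rule cong_mult) simp
    then show ?thesis using all by (simp add: falling_self)
  qed
next
  case (Suc t)
  let ?F = "\<Prod>l<g. fact (c l) :: int"
  let ?b = "t + Suc (\<Sum>l<g. s l) = (\<Sum>l<g. c l)"
  have sum: "(\<Sum>l<g. (s(k := Suc (s k))) l) = Suc (\<Sum>l<g. s l)" if "k < g" for k
    using that by (simp add: sum.remove[of _ k])
  have fall: "(\<Prod>l<g. falling (int (c l)) ((s(k := Suc (s k))) l))
      = (int (c k) - int (s k)) * (\<Prod>l<g. falling (int (c l)) (s l))" if "k < g" for k
    using that by (simp add: prod.remove[of _ k] falling_def)
  \<comment> \<open>Raising \<open>s k\<close> contributes the factor \<open>c k - s k\<close>; by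
    the degree condition these factors add up to \<open>Suc t\<close>, turning \<open>fact t\<close>
    into \<open>fact (Suc t)\<close>.\<close>
  have weights: "(\<Sum>k<g. fact t * ((int (c k) - int (s k)) * z)) = fact (Suc t) * z" if b: ?b for z
  proof -
    have "(\<Sum>k<g. fact t * ((int (c k) - int (s k)) * z)) = fact t * ((int (\<Sum>k<g. c k) - int (\<Sum>k<g. s k)) * z)"
      by (simp add: sum_distrib_left sum_distrib_right sum_subtractf left_diff_distrib right_diff_distrib)
    also have "int (\<Sum>k<g. c k) - int (\<Sum>k<g. s k) = int (Suc t)"
      unfolding b[symmetric] by simp
    finally show ?thesis by (simp add: mult_ac)
  qed
  have eq: "moment g c X u (Suc t) s * ?F = (\<Sum>k<g. moment g c X u t (s(k := Suc (s k))) * ?F)"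
    by (simp add: moment_Suc sum_distrib_right)
  have "[(\<Sum>k<g. moment g c X u t (s(k := Suc (s k))) * ?F)
    = (\<Sum>k<g. if ?b then fact t * ((int (c k) - int (s k)) * (\<Prod>l<g. falling (int (c l)) (s l))) else 0)] (mod q)"
  proof (rule cong_sum)
    fix k assume "k \<in> {..<g}"
    then have k: "k < g" by simp
    have "t + (\<Sum>l<g. (s(k := Suc (s k))) l) \<le> (\<Sum>l<g. c l)"
      unfolding sum[OF k] using Suc.prems by simp
    from Suc.IH[OF this]
    show "[moment g c X u t (s(k := Suc (s k))) * ?F =
        (if ?b then fact t * ((int (c k) - int (s k)) * (\<Prod>l<g. falling (int (c l)) (s l))) else 0)] (mod q)"
      unfolding sum[OF k] fall[OF k] .
  qed
  moreover have "(\<Sum>k<g. if ?b then fact t * ((int (c k) - int (s k)) * (\<Prod>l<g. falling (int (c l)) (s l))) else 0)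
    = (if ?b then fact (Suc t) * (\<Prod>l<g. falling (int (c l)) (s l)) else 0)"
  proof (cases ?b)
    case True
    show ?thesis unfolding if_P[OF True] by (rule weights[OF True])
  next
    case False
    show ?thesis unfolding if_not_P[OF False] by (rule sum.neutral_const)
  qed
  ultimately show ?case
    unfolding eq add_Suc add_Suc_right by (simp only:)
qed

lemma monic_poly_int_expand:
  fixes G :: "int poly"
  assumes "degree G = T" "lead_coeff G = 1"
  shows "poly G z = z ^ T + (\<Sum>t<T. coeff G t * z ^ t)"
  unfolding poly_altdef assms(1) lessThan_Suc_atMost[symmetric] using assms by simp

text \<open>If \<open>C\<close> had at most \<open>T\<close> elements, a monic \<open>G\<close> of
  degree \<open>T\<close> would vanish on it. The weighted sum over the grid of \<open>G\<close> at
  the coordinate sum, times the polynomial given by \<open>e\<close> and \<open>s\<close>, would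
  then be 0 modulo \<open>q\<close>. But only the top power of \<open>G\<close> contributes, and up
  to factorials it gives \<open>fact T\<close> times the number in \<open>nz\<close>, which is prime
  to \<open>q\<close>.\<close>

lemma polynomial_method:
  fixes q :: int and g :: nat
  assumes q: "prime q" and T: "int T < q"
    and X: "\<And>l i j. l < g \<Longrightarrow> i < j \<Longrightarrow> j \<le> c l \<Longrightarrow> \<not> [X l i = X l j] (mod q)"
    and "finite P" and sT: "\<And>p. p \<in> P \<Longrightarrow> T + (\<Sum>l<g. s p l) = (\<Sum>l<g. c l)"
    and nz: "\<not> q dvd (\<Sum>p\<in>P. e p * (\<Prod>l<g. falling (int (c l)) (s p l)))"
    and "finite C"
    and C: "\<And>j. j \<in> PiE {..<g} (\<lambda>l. {..c l}) \<Longrightarrow> (\<Sum>p\<in>P. e p * (\<Prod>l<g. X l (j l) ^ s p l)) \<noteq> 0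
      \<Longrightarrow> (\<Sum>l<g. X l (j l)) mod q \<in> C"
  shows "T < card C"
proof (rule ccontr)
  assume "\<not> T < card C"
  then have card: "card C \<le> T" by simp
  have "\<exists>u. \<forall>i\<le>c l. [(\<Sum>j\<le>c l. u j * X l j ^ i) = (if i = c l then 1 else 0)] (mod q)" if "l < g" for l
    using divided_difference_weights[OF q, of "c l" "X l"] X that by blast
  then obtain u where u: "\<And>l i. l < g \<Longrightarrow> i \<le> c l \<Longrightarrow>
      [(\<Sum>j\<le>c l. u l j * X l j ^ i) = (if i = c l then 1 else 0)] (mod q)"
    by metis
  let ?J = "PiE {..<g} (\<lambda>l. {..c l})"
  let ?F = "\<Prod>l<g. fact (c l) :: int"
  define V where "V j = (\<Sum>p\<in>P. e p * (\<Prod>l<g. X l (j l) ^ s p l))" for j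
  define U where "U j = (\<Prod>l<g. u l (j l))" for j
  define S where "S j = (\<Sum>l<g. X l (j l))" for j
  have mom: "(\<Sum>j\<in>?J. S j ^ t * V j * U j) = (\<Sum>p\<in>P. e p * moment g c X u t (s p))" for t
    unfolding moment_def V_def U_def S_def sum_distrib_left sum_distrib_right
    by (subst sum.swap) (intro sum.cong refl, simp add: prod.distrib mult_ac)
  have low: "q dvd (\<Sum>j\<in>?J. S j ^ t * V j * U j) * ?F" if "t < T" for t
  proof -
    have "q dvd moment g c X u t (s p) * ?F" if "p \<in> P" for p
      using moment_cong[where g = g and c = c and u = u and X = X and q = q, OF u, of t "s p"] sT[OF that] \<open>t < T\<close> by (simp add: cong_0_iff)
    then show ?thesis
      unfolding mom sum_distrib_right by (intro dvd_sum) (simp add: mult.assoc)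
  qed
  have top: "[(\<Sum>j\<in>?J. S j ^ T * V j * U j) * ?F =
      fact T * (\<Sum>p\<in>P. e p * (\<Prod>l<g. falling (int (c l)) (s p l)))] (mod q)"
  proof -
    have "[(\<Sum>p\<in>P. e p * (moment g c X u T (s p) * ?F))
        = (\<Sum>p\<in>P. e p * (fact T * (\<Prod>l<g. falling (int (c l)) (s p l))))] (mod q)"
    proof (rule cong_sum, rule cong_mult, rule cong_refl)
      fix p assume "p \<in> P"
      then show "[moment g c X u T (s p) * ?F = fact T * (\<Prod>l<g. falling (int (c l)) (s p l))] (mod q)"
        using moment_cong[where g = g and c = c and u = u and X = X and q = q, OF u, of T "s p"] sT by simp
    qed
    then show ?thesis
      unfolding mom by (simp add: sum_distrib_left sum_distrib_right mult_ac)
  qed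
  \<comment> \<open>\<open>G\<close> vanishes on \<open>C\<close>; the factor \<open>monom\<close> raises its degree to exactly \<open>T\<close>.\<close>
  define G where "G = monom 1 (T - card C) * (\<Prod>y\<in>C. [:- y, 1:])"
  have deg: "degree (\<Prod>y\<in>C. [:- y, 1:]) = card C"
    by (subst degree_prod_sum_eq) auto
  have lc: "lead_coeff (\<Prod>y\<in>C. [:- y, 1:]) = 1"
    by (subst lead_coeff_prod) simp
  then have "(\<Prod>y\<in>C. [:- y, 1:]) \<noteq> 0" by force
  then have "degree G = T"
    using card unfolding G_def by (simp add: degree_mult_eq degree_monom_eq deg)
  moreover have "lead_coeff G = 1"
    unfolding G_def lead_coeff_mult lc by (simp add: degree_monom_eq)
  ultimately have G: "degree G = T" "lead_coeff G = 1" by blast+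
  have "q dvd poly G (S j) * V j" if "j \<in> ?J" for j
  proof (cases "V j = 0")
    case False
    then have "S j mod q \<in> C"
      using C[OF that] by (simp add: V_def S_def)
    then have "(S j - S j mod q) dvd (\<Prod>y\<in>C. S j - y)"
      using \<open>finite C\<close> by (intro dvd_prodI)
    moreover have "q dvd S j - S j mod q"
      by (simp add: minus_mod_eq_mult_div)
    ultimately have "q dvd (\<Prod>y\<in>C. S j - y)" by (rule dvd_trans[rotated])
    moreover have "poly G (S j) = S j ^ (T - card C) * (\<Prod>y\<in>C. S j - y)"
      by (simp add: G_def poly_monom poly_prod)
    ultimately show ?thesis by simp
  qed simp
  then have "q dvd (\<Sum>j\<in>?J. poly G (S j) * V j * U j) * ?F"
    by (rule dvd_mult2[OF dvd_sum[OF dvd_mult2]])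
  also have "(\<Sum>j\<in>?J. poly G (S j) * V j * U j)
    = (\<Sum>j\<in>?J. S j ^ T * V j * U j) + (\<Sum>t<T. coeff G t * (\<Sum>j\<in>?J. S j ^ t * V j * U j))"
  proof -
    have "(\<Sum>j\<in>?J. poly G (S j) * V j * U j)
      = (\<Sum>j\<in>?J. S j ^ T * V j * U j) + (\<Sum>j\<in>?J. \<Sum>t<T. coeff G t * (S j ^ t * V j * U j))"
      unfolding monic_poly_int_expand[OF G]
      by (simp add: distrib_right sum.distrib sum_distrib_right mult.assoc)
    also have "(\<Sum>j\<in>?J. \<Sum>t<T. coeff G t * (S j ^ t * V j * U j))
      = (\<Sum>t<T. coeff G t * (\<Sum>j\<in>?J. S j ^ t * V j * U j))"
      by (subst sum.swap) (simp add: sum_distrib_left)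
    finally show ?thesis .
  qed
  finally have "q dvd (\<Sum>j\<in>?J. S j ^ T * V j * U j) * ?F
      + (\<Sum>t<T. coeff G t * ((\<Sum>j\<in>?J. S j ^ t * V j * U j) * ?F))"
    by (simp add: distrib_right sum_distrib_right mult.assoc)
  moreover have "q dvd (\<Sum>t<T. coeff G t * ((\<Sum>j\<in>?J. S j ^ t * V j * U j) * ?F))"
    by (rule dvd_sum, rule dvd_mult) (simp add: low)
  ultimately have "q dvd (\<Sum>j\<in>?J. S j ^ T * V j * U j) * ?F"
    using dvd_add_left_iff by blast
  then have "q dvd fact T * (\<Sum>p\<in>P. e p * (\<Prod>l<g. falling (int (c l)) (s p l)))"
    using top cong_dvd_iff by blast
  then have "q dvd fact T"
    using nz q prime_dvd_mult_iff by blast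
  moreover have "q = int (nat q)" using prime_ge_0_int[OF q] by simp
  ultimately have "nat q dvd fact T"
    by (metis int_dvd_int_iff of_nat_fact)
  moreover have "prime (nat q)" using q prime_int_nat_transfer by blast
  ultimately show False
    using T prime_dvd_fact_iff[of "nat q" T] by linarith
qed

section \<open>Determinants of falling factorials\<close>

text \<open>Induction on the degree, writing \<open>z - j\<close> as
  \<open>(z - a i) + (a i - j)\<close>. The leading coefficient 1 makes the change of basis
  unitriangular.\<close>

lemma falling_Newton_expansion:
  "\<exists>U :: nat \<Rightarrow> int. U j = 1 \<and> (\<forall>z. falling z j = (\<Sum>i\<le>j. U i * (\<Prod>r<i. z - a r)))"
proof (induction j)
  case 0
  show ?case by (rule exI[of _ "\<lambda>_. 1"]) (simp add: falling_def)
next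
  case (Suc j)
  then obtain U :: "nat \<Rightarrow> int" where U: "U j = 1" "\<And>z. falling z j = (\<Sum>i\<le>j. U i * (\<Prod>r<i. z - a r))"
    by blast
  define W where "W i = (if i = 0 then 0 else U (i - 1)) + (if i \<le> j then (a i - int j) * U i else 0)" for i
  have "falling z (Suc j) = (\<Sum>i\<le>Suc j. W i * (\<Prod>r<i. z - a r))" for z
  proof -
    let ?P = "\<lambda>i. \<Prod>r<i. z - a r"
    have "falling z (Suc j) = (\<Sum>i\<le>j. U i * ?P i * (z - int j))"
      by (simp add: falling_def U(2)[unfolded falling_def] sum_distrib_right)
    also have "\<dots> = (\<Sum>i\<le>j. U i * ?P (Suc i) + (a i - int j) * U i * ?P i)"
      by (rule sum.cong) (auto simp: algebra_simps)
    also have "\<dots> = (\<Sum>i\<le>j. U i * ?P (Suc i)) + (\<Sum>i\<le>j. (a i - int j) * U i * ?P i)"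
      by (rule sum.distrib)
    also have "(\<Sum>i\<le>j. U i * ?P (Suc i)) = (\<Sum>i\<le>Suc j. (if i = 0 then 0 else U (i - 1)) * ?P i)"
      by (subst sum.atMost_Suc_shift) simp
    also have "(\<Sum>i\<le>j. (a i - int j) * U i * ?P i) = (\<Sum>i\<le>Suc j. (if i \<le> j then (a i - int j) * U i else 0) * ?P i)"
      by (simp add: sum.atMost_Suc)
    finally show ?thesis
      by (simp add: W_def distrib_right sum.distrib)
  qed
  moreover have "W (Suc j) = 1" using U by (simp add: W_def)
  ultimately show ?case by blast
qed

text \<open>
  In the Newton basis at the points \<open>a r\<close> the matrix becomes lower triangular.
\<close>

lemma det_falling:
  "det (mat g g (\<lambda>(l, i). falling (a l) i)) = (\<Prod>l<g. \<Prod>r<l. a l - a r)"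
proof -
  from falling_Newton_expansion[of _ a]
  obtain U where U: "\<And>j. U j j = 1" "\<And>j z. falling z j = (\<Sum>i\<le>j. U j i * (\<Prod>r<i. z - a r))"
    by metis
  define L where "L = mat g g (\<lambda>(l, i). \<Prod>r<i. a l - a r)"
  define R where "R = mat g g (\<lambda>(i, j). if i \<le> j then U j i else 0)"
  have "mat g g (\<lambda>(l, i). falling (a l) i) = L * R"
  proof (rule eq_matI)
    fix l j assume "l < dim_row (L * R)" "j < dim_col (L * R)"
    then have lj: "l < g" "j < g" by (auto simp: L_def R_def)
    have "(L * R) $$ (l, j) = (\<Sum>i<g. (\<Prod>r<i. a l - a r) * (if i \<le> j then U j i else 0))"
      using lj by (simp add: L_def R_def scalar_prod_def atLeast0LessThan)
    also have "\<dots> = (\<Sum>i\<le>j. (\<Prod>r<i. a l - a r) * (if i \<le> j then U j i else 0))"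
      using lj by (intro sum.mono_neutral_right) auto
    also have "\<dots> = falling (a l) j"
      unfolding U(2) by (rule sum.cong) auto
    finally show "mat g g (\<lambda>(l, i). falling (a l) i) $$ (l, j) = (L * R) $$ (l, j)"
      using lj by simp
  qed (auto simp: L_def R_def)
  moreover have "det L = (\<Prod>l<g. \<Prod>r<l. a l - a r)"
  proof -
    \<comment> \<open>For \<open>l < i\<close> the entry contains the factor
      \<open>a l - a l\<close>.\<close>
    have "det L = prod_list (diag_mat L)"
      by (rule det_lower_triangular[of g]) (auto simp: L_def)
    also have "\<dots> = (\<Prod>l<g. \<Prod>r<l. a l - a r)"
      by (simp add: L_def diag_mat_def prod.distinct_set_conv_list[symmetric] atLeast0LessThan)
    finally show ?thesis .
  qed
  moreover have "det R = 1"
  proof -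
    have "det R = prod_list (diag_mat R)"
      by (rule det_upper_triangular) (auto simp: R_def upper_triangular_def)
    also have "\<dots> = 1"
      by (simp add: R_def diag_mat_def U prod.distinct_set_conv_list[symmetric])
    finally show ?thesis .
  qed
  moreover have "L \<in> carrier_mat g g" "R \<in> carrier_mat g g"
    by (auto simp: L_def R_def)
  ultimately show ?thesis
    by (simp add: det_mult)
qed

section \<open>Sumsets modulo a prime\<close>

text \<open>The Alon--Nathanson--Ruzsa theorem for initial segments of one enumeration. The
  polynomial is the Vandermonde determinant, expanded over permutations: it vanishes unless
  \<open>j\<close> is injective, and the number required to be prime to \<open>q\<close> is a
  product of differences \<open>c l - c r\<close> strictly between 0 and \<open>q\<close>.\<close>

lemma distinct_sums_mod_prime:
  fixes x :: "nat \<Rightarrow> int" and q :: int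
  assumes q: "prime q" and x: "\<And>i j. i < j \<Longrightarrow> j < d \<Longrightarrow> \<not> [x i = x j] (mod q)"
    and d: "int d \<le> q" and c: "\<And>l. l < g \<Longrightarrow> c l < d" and mono: "\<And>l k. l < k \<Longrightarrow> k < g \<Longrightarrow> c l < c k"
    and T: "(\<Sum>l<g. c l) = T + (\<Sum>l<g. l)" "int T < q"
  shows "T < card {(\<Sum>l<g. x (j l)) mod q |j. (\<forall>l<g. j l \<le> c l) \<and> inj_on j {..<g}}" (is "_ < card ?C")
proof -
  let ?P = "{p. p permutes {0..<g}}"
  have "?C \<subseteq> {0..<q}"
    using q prime_gt_0_int[OF q] by auto
  then have fin: "finite ?C" using finite_subset by blast
  have det: "det (mat g g (\<lambda>(l, i). f l i)) = (\<Sum>p\<in>?P. signof p * (\<Prod>l<g. f l (p l)))" for f :: "nat \<Rightarrow> nat \<Rightarrow> int"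
    by (subst det_def'[of _ g]) (auto simp: atLeast0LessThan permutes_in_image intro!: sum.cong prod.cong)
  show ?thesis
  proof (rule polynomial_method[OF q T(2), where X = "\<lambda>l. x" and s = "\<lambda>p. p" and e = signof and P = ?P and c = c and g = g])
    show "\<not> [x i = x j] (mod q)" if "l < g" "i < j" "j \<le> c l" for l i j
      using x c that by (meson le_less_trans)
    show "T + (\<Sum>l<g. p l) = (\<Sum>l<g. c l)" if "p \<in> ?P" for p
      using that sum.permute[of p "{..<g}" "\<lambda>l. l"] T by (simp add: atLeast0LessThan)
    have "\<not> q dvd (\<Prod>l<g. \<Prod>r<l. int (c l) - int (c r))"
    proof
      assume "q dvd (\<Prod>l<g. \<Prod>r<l. int (c l) - int (c r))"
      then obtain l r where "l < g" "r < l" "q dvd int (c l) - int (c r)"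
        using q by (auto simp: prime_dvd_prod_iff)
      moreover from this have "0 < int (c l) - int (c r)" "int (c l) - int (c r) < q"
        using mono[of r l] c[of l] d by auto
      ultimately show False using zdvd_imp_le by fastforce
    qed
    then show "\<not> q dvd (\<Sum>p\<in>?P. signof p * (\<Prod>l<g. falling (int (c l)) (p l)))"
      using det_falling[of g "\<lambda>l. int (c l)"] unfolding det by simp
    show "(\<Sum>l<g. x (j l)) mod q \<in> ?C"
      if "j \<in> PiE {..<g} (\<lambda>l. {..c l})" and nz: "(\<Sum>p\<in>?P. signof p * (\<Prod>l<g. x (j l) ^ p l)) \<noteq> 0" for j
    proof -
      have "inj_on j {..<g}"
      proof (rule inj_onI, rule ccontr)
        fix k l assume kl: "k \<in> {..<g}" "l \<in> {..<g}" "j k = j l" "k \<noteq> l"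
        have "det (mat g g (\<lambda>(l, i). x (j l) ^ i)) = 0"
          by (rule det_identical_rows[of _ g k l]) (use kl in \<open>auto simp: row_def\<close>)
        then show False using nz unfolding det by simp
      qed
      then show ?thesis using that by (auto simp: PiE_iff)
    qed
  qed (auto simp: fin finite_permutations)
qed

text \<open>The polynomial method in two variables with the constant polynomial 1: no pair is
  excluded, and the nondivisibility condition says that \<open>q\<close> does not divide 1.\<close>

lemma cauchy_davenport_mod_prime:
  fixes x y :: "nat \<Rightarrow> int" and q :: int
  assumes q: "prime q" and x: "\<And>i j. i < j \<Longrightarrow> j \<le> a \<Longrightarrow> \<not> [x i = x j] (mod q)"
    and y: "\<And>i j. i < j \<Longrightarrow> j \<le> b \<Longrightarrow> \<not> [y i = y j] (mod q)" and ab: "int (a + b) < q"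
  shows "a + b < card {(x i + y j) mod q |i j. i \<le> a \<and> j \<le> b}" (is "_ < card ?C")
proof -
  have "?C \<subseteq> {0..<q}"
    using q prime_gt_0_int[OF q] by auto
  then have fin: "finite ?C" using finite_subset by blast
  have less2: "{..<2} = {0, 1::nat}" by auto
  show ?thesis
  proof (rule polynomial_method[OF q ab, where X = "\<lambda>l. if l = 0 then x else y" and s = "\<lambda>p l. 0"
        and e = "\<lambda>_. 1" and P = "{()}" and c = "\<lambda>l. if l = 0 then a else b" and g = 2])
    show "\<not> [(if l = 0 then x else y) i = (if l = 0 then x else y) j] (mod q)"
      if "l < 2" "i < j" "j \<le> (if l = 0 then a else b)" for l :: nat and i j
      using that x y by (auto split: if_splits)
    show "\<not> q dvd (\<Sum>p\<in>{()}. 1 * (\<Prod>l<2. falling (int (if l = 0 then a else b)) 0))"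
      using prime_gt_1_int[OF q] by (simp add: falling_def)
    show "(\<Sum>l<2. (if l = 0 then x else y) (j l)) mod q \<in> ?C"
      if "j \<in> PiE {..<2} (\<lambda>l. {..if l = 0 then a else b})" for j :: "nat \<Rightarrow> nat"
      using that by (auto simp: less2 PiE_iff)
  qed (auto simp: fin less2)
qed

section \<open>Counting over the residues modulo a prime\<close>

text \<open>Greedy choice: \<open>Y t\<close> has more than \<open>t\<close> elements, so it
  contains one different from the \<open>t\<close> chosen before, and lower bounds at distinct
  points add up.\<close>

lemma sum_ge_by_distinct_representatives:
  fixes f :: "'b \<Rightarrow> nat" and v :: "nat \<Rightarrow> int"
  assumes "finite Z" and Y: "\<And>t. t \<le> T \<Longrightarrow> Y t \<subseteq> Z" "\<And>t. t \<le> T \<Longrightarrow> t < card (Y t)"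
    and v: "\<And>t y. t \<le> T \<Longrightarrow> y \<in> Y t \<Longrightarrow> v t \<le> int (f y)"
  shows "(\<Sum>t\<le>T. v t) \<le> int (\<Sum>y\<in>Z. f y)"
proof -
  have "\<exists>S\<subseteq>Z. card S = Suc t \<and> (\<Sum>i\<le>t. v i) \<le> int (\<Sum>y\<in>S. f y)" if "t \<le> T" for t
    using that
  proof (induction t)
    case 0
    then have "Y 0 \<noteq> {}" using Y(2)[of 0] by force
    then obtain y where "y \<in> Y 0" by blast
    then show ?case using Y(1)[of 0] v[of 0 y] by (intro exI[of _ "{y}"]) auto
  next
    case (Suc t)
    then obtain S where S: "S \<subseteq> Z" "card S = Suc t" "(\<Sum>i\<le>t. v i) \<le> int (\<Sum>y\<in>S. f y)"
      by force
    have fin: "finite S" using S \<open>finite Z\<close> finite_subset by blast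
    have "\<not> card (Y (Suc t)) \<le> card S"
      using Y(2)[OF Suc.prems] S(2) by simp
    then have "\<not> Y (Suc t) \<subseteq> S"
      using card_mono[OF fin] by blast
    then obtain y where y: "y \<in> Y (Suc t)" "y \<notin> S" by blast
    have "v (Suc t) \<le> int (f y)" using v[OF Suc.prems y(1)] .
    then have "(\<Sum>i\<le>Suc t. v i) \<le> int (\<Sum>y\<in>insert y S. f y)"
      using S(3) fin y(2) by simp
    moreover have "insert y S \<subseteq> Z" "card (insert y S) = Suc (Suc t)"
      using S fin y Y(1)[OF Suc.prems] by auto
    ultimately show ?case by blast
  qed
  then obtain S where S: "S \<subseteq> Z" "(\<Sum>i\<le>T. v i) \<le> int (\<Sum>y\<in>S. f y)" by blast
  moreover have "(\<Sum>y\<in>S. f y) \<le> (\<Sum>y\<in>Z. f y)"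
    using S \<open>finite Z\<close> by (intro sum_mono2) auto
  ultimately show ?thesis by linarith
qed

lemma sum_lessThan_add:
  fixes F :: "nat \<Rightarrow> 'b::comm_monoid_add"
  shows "(\<Sum>t<a + b. F t) = (\<Sum>t<a. F t) + (\<Sum>t<b. F (t + a))"
  by (induction b) (simp_all add: ac_simps)

text \<open>
  The chain moves the \<open>g\<close>-set \<open>{0..<g}\<close> to \<open>{e..<g + e}\<close>, shifting its largest element first, and
  every index is covered at least \<open>g\<close> times.
\<close>

lemma chain_of_index_sets:
  fixes w :: "nat \<Rightarrow> int"
  assumes w: "\<And>j. 0 \<le> w j" and e: "1 \<le> e"
  shows "\<exists>c. (\<forall>t\<le>g * e. (\<forall>l k. l < k \<longrightarrow> k < g \<longrightarrow> c t l < c t k) \<and> (\<forall>l<g. c t l < g + e)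
      \<and> (\<Sum>l<g. c t l) = t + (\<Sum>l<g. l))
    \<and> int g * (\<Sum>j<g + e. w j) \<le> (\<Sum>t\<le>g * e. \<Sum>l<g. w (c t l))"
proof (induction g)
  case 0
  show ?case by simp
next
  case (Suc g)
  then obtain c where c: "\<And>t l k. t \<le> g * e \<Longrightarrow> l < k \<Longrightarrow> k < g \<Longrightarrow> c t l < c t k"
      "\<And>t l. t \<le> g * e \<Longrightarrow> l < g \<Longrightarrow> c t l < g + e"
      "\<And>t. t \<le> g * e \<Longrightarrow> (\<Sum>l<g. c t l) = t + (\<Sum>l<g. l)"
      and sum: "int g * (\<Sum>j<g + e. w j) \<le> (\<Sum>t\<le>g * e. \<Sum>l<g. w (c t l))"
    by blast
  \<comment> \<open>For \<open>t < e\<close> only the new largest index moves, from \<open>g\<close>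
    towards \<open>g + e\<close>; it then rests at \<open>g + e\<close> while the chain for
    \<open>g\<close> runs with a delay of \<open>e\<close>.\<close>
  define c' where "c' t l = (if t < e then if l < g then l else g + t
      else if l < g then c (t - e) l else g + e)" for t l :: nat
  have "(\<forall>l k. l < k \<longrightarrow> k < Suc g \<longrightarrow> c' t l < c' t k) \<and> (\<forall>l<Suc g. c' t l < Suc g + e)
      \<and> (\<Sum>l<Suc g. c' t l) = t + (\<Sum>l<Suc g. l)" if t: "t \<le> Suc g * e" for t
  proof (cases "t < e")
    case True
    then show ?thesis by (auto simp: c'_def)
  next
    case False
    then have te: "t - e \<le> g * e" using t by simp
    then show ?thesis
      using False c(1,2)[OF te] c(3)[OF te] by (auto simp: c'_def less_Suc_eq)
  qed
  moreover have "int (Suc g) * (\<Sum>j<Suc g + e. w j) \<le> (\<Sum>t\<le>Suc g * e. \<Sum>l<Suc g. w (c' t l))"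
  proof -
    have "(\<Sum>t\<le>Suc g * e. \<Sum>l<Suc g. w (c' t l)) =
        (\<Sum>t<e + Suc (g * e). \<Sum>l<Suc g. w (c' t l))"
      by (simp add: lessThan_Suc_atMost)
    also have "\<dots> = (\<Sum>t<e. \<Sum>l<Suc g. w (c' t l)) + (\<Sum>t<Suc (g * e). \<Sum>l<Suc g. w (c' (t + e) l))"
      by (rule sum_lessThan_add)
    also have "(\<Sum>t<e. \<Sum>l<Suc g. w (c' t l)) = int e * (\<Sum>l<g. w l) + (\<Sum>t<e. w (g + t))"
      by (simp add: c'_def sum.distrib)
    also have "(\<Sum>t<Suc (g * e). \<Sum>l<Suc g. w (c' (t + e) l))
        = (\<Sum>t<Suc (g * e). (\<Sum>l<g. w (c t l)) + w (g + e))"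
      by (rule sum.cong) (simp_all add: c'_def)
    also have "\<dots> = (\<Sum>t\<le>g * e. \<Sum>l<g. w (c t l)) + int (g * e + 1) * w (g + e)"
      by (simp add: sum.distrib lessThan_Suc_atMost del: sum.lessThan_Suc)
    finally have eq: "(\<Sum>t\<le>Suc g * e. \<Sum>l<Suc g. w (c' t l)) = int e * (\<Sum>l<g. w l) + (\<Sum>t<e. w (g + t))
      + ((\<Sum>t\<le>g * e. \<Sum>l<g. w (c t l)) + int (g * e + 1) * w (g + e))" .
    \<comment> \<open>The first phase covers every index below \<open>g + e\<close> at least once,
      on top of the \<open>g\<close> coverings by the old chain; the index \<open>g + e\<close> is
      covered \<open>g * e + 1\<close> times, hence at least \<open>g + 1\<close> times.\<close>
    have "(\<Sum>l<g. w l) \<le> int e * (\<Sum>l<g. w l)"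
      using e w mult_right_mono[of 1 "int e" "\<Sum>l<g. w l"] by (simp add: sum_nonneg)
    moreover have "(\<Sum>j<g + e. w j) = (\<Sum>l<g. w l) + (\<Sum>t<e. w (g + t))"
      unfolding sum_lessThan_add by (simp add: add.commute)
    moreover have "int (Suc g) * w (g + e) \<le> int (g * e + 1) * w (g + e)"
    proof (rule mult_right_mono)
      have "g \<le> g * e" using e by (cases e) auto
      then show "int (Suc g) \<le> int (g * e + 1)" by linarith
    qed (rule w)
    ultimately have "(\<Sum>j<g + e. w j) + int g * (\<Sum>j<g + e. w j) + int (Suc g) * w (g + e)
        \<le> (\<Sum>t\<le>Suc g * e. \<Sum>l<Suc g. w (c' t l))"
      unfolding eq using sum by linarith
    moreover have "int (Suc g) * (\<Sum>j<Suc g + e. w j)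
      = (\<Sum>j<g + e. w j) + int g * (\<Sum>j<g + e. w j) + int (Suc g) * w (g + e)"
      by (simp add: algebra_simps)
    ultimately show ?thesis by linarith
  qed
  ultimately show ?case by (intro exI[of _ c']) blast
qed

lemma antimono_enumeration:
  fixes w :: "'b::linorder \<Rightarrow> int"
  assumes "finite D"
  obtains x where "bij_betw x {..<card D} D" "\<And>i j. i \<le> j \<Longrightarrow> j < card D \<Longrightarrow> w (x j) \<le> w (x i)"
proof -
  define xs where "xs = sort_key (\<lambda>y. - w y) (sorted_list_of_set D)"
  have xs: "distinct xs" "set xs = D" "length xs = card D" "sorted (map (\<lambda>y. - w y) xs)"
    using assms by (auto simp: xs_def)
  have "bij_betw ((!) xs) {..<card D} D"
    by (rule bij_betw_nth) (simp_all add: xs)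
  moreover have "w (xs ! j) \<le> w (xs ! i)" if "i \<le> j" "j < card D" for i j
    using xs(3,4) that sorted_nth_mono[of "map (\<lambda>y. - w y) xs" i j] by simp
  ultimately show ?thesis using that by blast
qed

text \<open>The double sum of \<open>(a x - a y) * (b x - b y)\<close> over \<open>D\<close> is
  twice the difference of the two sides.\<close>

lemma Chebyshev_sum_product:
  fixes a b :: "'b \<Rightarrow> int"
  assumes "\<And>x y. x \<in> D \<Longrightarrow> y \<in> D \<Longrightarrow> 0 \<le> (a x - a y) * (b x - b y)"
  shows "(\<Sum>x\<in>D. a x) * (\<Sum>x\<in>D. b x) \<le> int (card D) * (\<Sum>x\<in>D. a x * b x)"
proof -
  have "0 \<le> (\<Sum>x\<in>D. \<Sum>y\<in>D. (a x - a y) * (b x - b y))"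
    using assms by (intro sum_nonneg) auto
  also have "\<dots> = (\<Sum>x\<in>D. \<Sum>y\<in>D. a x * b x) + (\<Sum>x\<in>D. \<Sum>y\<in>D. a y * b y)
      - (\<Sum>x\<in>D. \<Sum>y\<in>D. a x * b y) - (\<Sum>x\<in>D. \<Sum>y\<in>D. a y * b x)"
    by (simp add: algebra_simps sum.distrib sum_subtractf)
  also have "(\<Sum>x\<in>D. \<Sum>y\<in>D. a x * b x) = int (card D) * (\<Sum>x\<in>D. a x * b x)"
    by (simp add: sum_distrib_left)
  also have "(\<Sum>x\<in>D. \<Sum>y\<in>D. a y * b y) = int (card D) * (\<Sum>x\<in>D. a x * b x)"
    by simp
  also have "(\<Sum>x\<in>D. \<Sum>y\<in>D. a y * b x) = (\<Sum>x\<in>D. \<Sum>y\<in>D. a x * b y)"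
    by (rule sum.swap)
  also have "(\<Sum>x\<in>D. \<Sum>y\<in>D. a x * b y) = (\<Sum>x\<in>D. a x) * (\<Sum>x\<in>D. b x)"
    by (simp add: sum_product)
  finally show ?thesis by linarith
qed

lemma inj_on_add_mod: "inj_on (\<lambda>y. (s + y) mod q) {0..<q}" for q :: int
proof (rule inj_onI)
  fix x y assume xy: "x \<in> {0..<q}" "y \<in> {0..<q}" "(s + x) mod q = (s + y) mod q"
  then have "(s + x - s) mod q = (s + y - s) mod q" by (metis mod_diff_left_eq)
  then show "x = y" using xy by simp
qed

lemma card_add_mod_image:
  fixes q :: int
  assumes "Y \<subseteq> {0..<q}"
  shows "card ((\<lambda>y. (s + y) mod q) ` Y) = card Y"
  using inj_on_add_mod inj_on_subset[OF _ assms] by (intro card_image) blast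

text \<open>
  \<open>k x\<close> is the size of the fibre of \<open>B\<close> over the residue \<open>x\<close>, and \<open>f y\<close> is the number of sums of
  \<open>h\<close> distinct elements of \<open>B\<close> over \<open>y\<close>.
\<close>

locale residue_fibres =
  fixes q :: int and D :: "int set" and k :: "int \<Rightarrow> nat" and f :: "int \<Rightarrow> nat" and h :: nat
  assumes q: "prime q" and D: "D \<subseteq> {0..<q}"
    and fibre: "\<And>\<eta>. (\<And>x. x \<in> D \<Longrightarrow> \<eta> x \<le> k x) \<Longrightarrow> (\<Sum>x\<in>D. \<eta> x) = h \<Longrightarrow>
      1 + (\<Sum>x\<in>D. int (\<eta> x) * (int (k x) - int (\<eta> x))) \<le> int (f ((\<Sum>x\<in>D. int (\<eta> x) * x) mod q))"
begin

abbreviation spread :: "(int \<Rightarrow> nat) \<Rightarrow> int" where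
  "spread \<eta> \<equiv> \<Sum>x\<in>D. int (\<eta> x) * (int (k x) - int (\<eta> x))"

lemma finite_D: "finite D"
  using D finite_subset by blast

lemma card_D_le: "int (card D) \<le> q"
  using card_mono[OF _ D] prime_ge_0_int[OF q] by simp

lemma q_pos: "0 < q"
  using q prime_gt_0_int by blast

lemma spread_nonneg: "(\<And>x. x \<in> D \<Longrightarrow> \<eta> x \<le> k x) \<Longrightarrow> 0 \<le> spread \<eta>"
  by (intro sum_nonneg) simp

lemma not_cong_on_D:
  assumes "bij_betw x {..<card D} D" "i < j" "j < card D"
  shows "\<not> [x i = x j] (mod q)"
proof -
  have "x i \<in> D" "x j \<in> D" "x i \<noteq> x j"
    using assms by (auto simp: bij_betw_def inj_on_def)
  then show ?thesis using D by (auto simp: cong_def subset_iff)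
qed

text \<open>Settles the cases in which the construction already reaches every residue: the
  \<open>q\<close> in the minimum is then attained with one sum per residue.\<close>

lemma full_support_bound:
  assumes "Y \<subseteq> {0..<q}" "\<And>y. y \<in> Y \<Longrightarrow> 1 \<le> f y" "q \<le> int (card Y)"
  shows "q \<le> int (\<Sum>y\<in>{0..<q}. f y)"
proof -
  have "card Y \<le> (\<Sum>y\<in>Y. f y)"
    using sum_mono[of Y "\<lambda>_. 1" f] assms(2) by simp
  also have "\<dots> \<le> (\<Sum>y\<in>{0..<q}. f y)"
    using assms(1) by (intro sum_mono2) auto
  finally show ?thesis using assms(3) by linarith
qed

text \<open>
  Adding the indicator of \<open>S\<close> to \<open>\<rho>\<close> changes the spread by the sum over \<open>S\<close> of
  \<open>k x - 2 * \<rho> x - 1\<close>. With the residues enumerated in decreasing order of this weight,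
  every set below a member of the chain has at least the weight of that member.
\<close>

lemma bound_by_subset_perturbation:
  assumes \<rho>: "\<And>x. x \<in> D \<Longrightarrow> 2 * \<rho> x + 1 \<le> k x"
    and h: "(\<Sum>x\<in>D. \<rho> x) + g = h" and g: "1 \<le> g" "g < card D"
    and Cheb: "(\<Sum>x\<in>D. int (\<rho> x)) * (\<Sum>x\<in>D. int (k x) - int (\<rho> x)) \<le> int (card D) * spread \<rho>"
  shows "min q (1 + int h * (int (\<Sum>x\<in>D. k x) - int h)) \<le> int (\<Sum>y\<in>{0..<q}. f y)"
proof -
  \<comment> \<open>The value 0 outside \<open>D\<close> keeps \<open>w\<close> nonnegative
    everywhere: the chain lemma wants this at all indices, and \<open>x j\<close> is arbitrary for
    \<open>j\<close> beyond the enumeration.\<close>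
  define w where "w y = (if y \<in> D then int (k y) - 2 * int (\<rho> y) - 1 else 0)" for y
  have w_nonneg: "0 \<le> w y" for y using \<rho>[of y] by (auto simp: w_def)
  obtain x where bij: "bij_betw x {..<card D} D" and anti: "\<And>i j. i \<le> j \<Longrightarrow> j < card D \<Longrightarrow> w (x j) \<le> w (x i)"
    using antimono_enumeration[OF finite_D, of w] by blast
  define e where "e = card D - g"
  have ge: "g + e = card D" "1 \<le> e" using g by (auto simp: e_def)
  obtain c where c: "\<And>t l k. t \<le> g * e \<Longrightarrow> l < k \<Longrightarrow> k < g \<Longrightarrow> c t l < c t k"
      "\<And>t l. t \<le> g * e \<Longrightarrow> l < g \<Longrightarrow> c t l < card D"
      "\<And>t. t \<le> g * e \<Longrightarrow> (\<Sum>l<g. c t l) = t + (\<Sum>l<g. l)"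
      and csum: "int g * (\<Sum>j<card D. w (x j)) \<le> (\<Sum>t\<le>g * e. \<Sum>l<g. w (x (c t l)))"
    using chain_of_index_sets[of "\<lambda>j. w (x j)" e g] ge w_nonneg by metis
  define s where "s = (\<Sum>y\<in>D. int (\<rho> y) * y)"
  define Y0 where "Y0 t = {(\<Sum>l<g. x (j l)) mod q |j. (\<forall>l<g. j l \<le> c t l) \<and> inj_on j {..<g}}" for t
  define Y where "Y t = (\<lambda>y. (s + y) mod q) ` Y0 t" for t
  have Y0: "Y0 t \<subseteq> {0..<q}" for t using q_pos by (auto simp: Y0_def)
  have Y: "Y t \<subseteq> {0..<q}" for t using q_pos by (auto simp: Y_def)
  have cardY: "t < card (Y t)" if "t \<le> g * e" "int t < q" for t
    unfolding Y_def card_add_mod_image[OF Y0] unfolding Y0_def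
    by (rule distinct_sums_mod_prime[OF q not_cong_on_D[OF bij] card_D_le])
       (use that c in auto)
  have fY: "1 + spread \<rho> + (\<Sum>l<g. w (x (c t l))) \<le> int (f y)" if t: "t \<le> g * e" and y: "y \<in> Y t" for t y
  proof -
    obtain j where j: "\<And>l. l < g \<Longrightarrow> j l \<le> c t l" "inj_on j {..<g}"
        and yj: "y = (s + (\<Sum>l<g. x (j l)) mod q) mod q"
      using y unfolding Y_def Y0_def by blast
    define S where "S = (\<lambda>l. x (j l)) ` {..<g}"
    have jD: "j l < card D" if "l < g" for l
      using j(1)[OF that] c(2)[OF t that] by simp
    have inj: "inj_on (\<lambda>l. x (j l)) {..<g}"
      using j(2) bij jD unfolding bij_betw_def inj_on_def by (metis lessThan_iff)
    have SD: "S \<subseteq> D" using bij jD by (auto simp: S_def bij_betw_def)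
    have cS: "card S = g" unfolding S_def by (simp add: card_image[OF inj])
    define \<eta> where "\<eta> y = \<rho> y + (if y \<in> S then 1 else 0)" for y
    have ind: "(\<Sum>y\<in>D. if y \<in> S then F y else 0) = (\<Sum>y\<in>S. F y)" for F :: "int \<Rightarrow> int"
      using SD finite_D by (simp add: sum.inter_restrict[symmetric] Int_absorb1)
    have \<eta>_le: "\<eta> y \<le> k y" if "y \<in> D" for y using \<rho>[OF that] by (auto simp: \<eta>_def)
    have "(\<Sum>y\<in>D. if y \<in> S then 1 else 0) = g"
      using SD finite_D cS by (simp add: sum.inter_restrict[symmetric] Int_absorb1)
    then have \<eta>_sum: "(\<Sum>y\<in>D. \<eta> y) = h" using h by (simp add: \<eta>_def sum.distrib)
    have "int (\<eta> y) * (int (k y) - int (\<eta> y)) = int (\<rho> y) * (int (k y) - int (\<rho> y)) + (if y \<in> S then w y else 0)" for y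
      using SD by (auto simp: \<eta>_def w_def algebra_simps)
    then have "spread \<eta> = spread \<rho> + (\<Sum>y\<in>S. w y)"
      by (simp add: sum.distrib ind)
    moreover have "(\<Sum>y\<in>S. w y) = (\<Sum>l<g. w (x (j l)))"
      unfolding S_def by (simp add: sum.reindex[OF inj] o_def)
    moreover have "(\<Sum>l<g. w (x (c t l))) \<le> (\<Sum>l<g. w (x (j l)))"
      using anti j(1) c(2)[OF t] by (intro sum_mono) auto
    moreover have "y = (\<Sum>y\<in>D. int (\<eta> y) * y) mod q"
    proof -
      have "int (\<eta> y) * y = int (\<rho> y) * y + (if y \<in> S then y else 0)" for y
        by (auto simp: \<eta>_def algebra_simps)
      then have "(\<Sum>y\<in>D. int (\<eta> y) * y) = s + (\<Sum>y\<in>S. y)"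
        by (simp add: s_def sum.distrib ind)
      also have "(\<Sum>y\<in>S. y) = (\<Sum>l<g. x (j l))"
        unfolding S_def by (simp add: sum.reindex[OF inj] o_def)
      finally show ?thesis by (simp add: yj mod_simps)
    qed
    ultimately show ?thesis using fibre[OF \<eta>_le \<eta>_sum] by simp
  qed
  have "0 \<le> spread \<rho>" using \<rho> by (intro spread_nonneg) force
  show ?thesis
  proof (cases "int (g * e) < q")
    case False
    \<comment> \<open>The index \<open>q - 1\<close> is the last one with \<open>int t < q\<close>,
      and its set already has \<open>q\<close> elements.\<close>
    then have "nat (q - 1) \<le> g * e" "int (nat (q - 1)) < q" using q_pos by linarith+
    then have "q \<le> int (card (Y (nat (q - 1))))" using cardY[of "nat (q - 1)"] by linarith
    moreover have "1 \<le> f y" if "y \<in> Y (nat (q - 1))" for y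
    proof -
      have "0 \<le> (\<Sum>l<g. w (x (c (nat (q - 1)) l)))" using w_nonneg by (intro sum_nonneg) auto
      then show ?thesis
        using fY[OF \<open>nat (q - 1) \<le> g * e\<close> that] \<open>0 \<le> spread \<rho>\<close> by linarith
    qed
    ultimately have "q \<le> int (\<Sum>y\<in>{0..<q}. f y)"
      using full_support_bound[OF Y] by blast
    then show ?thesis by linarith
  next
    case True
    define R where "R = int (\<Sum>x\<in>D. \<rho> x)"
    define K where "K = int (\<Sum>x\<in>D. k x)"
    have "(\<Sum>t\<le>g * e. 1 + spread \<rho> + (\<Sum>l<g. w (x (c t l)))) \<le> int (\<Sum>y\<in>{0..<q}. f y)"
      by (rule sum_ge_by_distinct_representatives[where Y = Y]) (use True Y fY in \<open>auto intro!: cardY simp del: of_nat_mult\<close>)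
    also have "(\<Sum>t\<le>g * e. 1 + spread \<rho> + (\<Sum>l<g. w (x (c t l))))
      = int (g * e + 1) * (1 + spread \<rho>) + (\<Sum>t\<le>g * e. \<Sum>l<g. w (x (c t l)))"
      by (simp add: sum.distrib)
    finally have 1: "int (g * e + 1) * (1 + spread \<rho>) + int g * (\<Sum>j<card D. w (x j)) \<le> int (\<Sum>y\<in>{0..<q}. f y)"
      using csum by linarith
    have "(\<Sum>j<card D. w (x j)) = (\<Sum>y\<in>D. w y)"
      using bij by (rule sum.reindex_bij_betw)
    also have "\<dots> = K - 2 * R - int (card D)"
      by (simp add: w_def sum_subtractf K_def R_def sum_distrib_left)
    finally have 2: "(\<Sum>j<card D. w (x j)) = K - 2 * R - int (card D)" .
    \<comment> \<open>This is \<open>(g - 1) * (e - 1) \<ge> 0\<close>. It lets the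
      \<open>g * e + 1\<close> members of the chain supply the factor \<open>card D\<close> in
      Chebyshev's inequality.\<close>
    have "card D \<le> g * e + 1"
    proof -
      obtain a b where "g = Suc a" "e = Suc b" using g ge by (metis Suc_le_D One_nat_def)
      then show ?thesis using ge by simp
    qed
    then have "int (card D) \<le> int (g * e + 1)" by (rule of_nat_mono)
    then have "int (card D) * spread \<rho> \<le> int (g * e + 1) * spread \<rho>"
      using \<open>0 \<le> spread \<rho>\<close> by (rule mult_right_mono)
    moreover have "R * (K - R) \<le> int (card D) * spread \<rho>"
      using Cheb by (simp add: R_def K_def sum_subtractf)
    ultimately have 3: "int (g * e + 1) + R * (K - R) \<le> int (g * e + 1) * (1 + spread \<rho>)"
      by (simp add: distrib_left)
    have "int h = R + int g" using h by (simp add: R_def flip: of_nat_sum)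
    moreover have "int (card D) = int g + int e" using ge by linarith
    \<comment> \<open>Substituting \<open>h = R + g\<close> splits \<open>h * (K - h)\<close> into
      \<open>R * (K - R)\<close> and \<open>g * (K - 2 * R - g)\<close>; the rest is
      \<open>card D = g + e\<close>.\<close>
    ultimately have "1 + int h * (K - int h) = int (g * e + 1) + R * (K - R) + int g * (K - 2 * R - int (card D))"
      by (simp add: algebra_simps)
    then show ?thesis using 1 3 unfolding 2 K_def by linarith
  qed
qed

text \<open>
  The degenerate case \<open>g = card D\<close>. Moving one unit from \<open>z\<close> to \<open>y\<close> reaches at least
  \<open>2 * card D - 1\<close> residues as \<open>y - z\<close> varies; for one suitable \<open>z\<close> and all \<open>y\<close> it lowers the
  spread by at most two.
\<close>

lemma bound_by_swaps:
  assumes \<eta>: "\<And>x. x \<in> D \<Longrightarrow> 1 \<le> \<eta> x \<and> \<eta> x < k x" and h: "(\<Sum>x\<in>D. \<eta> x) = h" and "D \<noteq> {}"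
    and Cheb: "(\<Sum>x\<in>D. int (\<eta> x)) * (\<Sum>x\<in>D. int (k x) - int (\<eta> x)) \<le> int (card D) * spread \<eta>"
  shows "min q (1 + int h * (int (\<Sum>x\<in>D. k x) - int h)) \<le> int (\<Sum>y\<in>{0..<q}. f y)"
proof -
  define s where "s = (\<Sum>y\<in>D. int (\<eta> y) * y)"
  \<comment> \<open>Increasing \<open>\<eta> y\<close> by one changes the spread by
    \<open>a y - 1\<close>, and decreasing \<open>\<eta> z\<close> by one changes it by
    \<open>- a z - 1\<close>.\<close>
  define a where "a y = int (k y) - 2 * int (\<eta> y)" for y
  define d where "d = card D"
  have d: "1 \<le> d" using \<open>D \<noteq> {}\<close> finite_D by (simp add: d_def Suc_le_eq card_gt_0_iff)
  have swap: "1 + spread \<eta> + a y - a z - 2 \<le> int (f ((s + y - z) mod q)) \<and> 1 \<le> f ((s + y - z) mod q)"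
    if yz: "y \<in> D" "z \<in> D" "y \<noteq> z" for y z
  proof -
    define \<theta> where "\<theta> = \<eta>(y := \<eta> y + 1, z := \<eta> z - 1)"
    have \<theta>_le: "\<theta> u \<le> k u" if "u \<in> D" for u
      using \<eta>[OF that] \<eta>[OF yz(1)] by (auto simp: \<theta>_def)
    have split: "(\<Sum>u\<in>D. F u) = F y + F z + (\<Sum>u\<in>D - {y} - {z}. F u)" for F :: "int \<Rightarrow> 'c::comm_monoid_add"
      using finite_D yz by (simp add: sum.remove[of D y] sum.remove[of "D - {y}" z] add.assoc)
    have rest: "(\<Sum>u\<in>D - {y} - {z}. F u (\<theta> u)) = (\<Sum>u\<in>D - {y} - {z}. F u (\<eta> u))" for F :: "int \<Rightarrow> nat \<Rightarrow> 'c::comm_monoid_add"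
      by (rule sum.cong) (auto simp: \<theta>_def)
    have \<theta>_y: "\<theta> y = \<eta> y + 1" and \<theta>_z: "\<theta> z = \<eta> z - 1" using yz by (auto simp: \<theta>_def)
    have z1: "1 \<le> \<eta> z" using \<eta> yz by blast
    have "(\<Sum>u\<in>D. \<theta> u) = (\<Sum>u\<in>D. \<eta> u)"
      unfolding split[of \<theta>] split[of \<eta>] rest[of "\<lambda>u n. n"] \<theta>_y \<theta>_z using z1 by simp
    then have \<theta>_sum: "(\<Sum>u\<in>D. \<theta> u) = h" using h by simp
    have "(\<Sum>u\<in>D. int (\<theta> u) * u) = s + y - z"
      unfolding s_def split[of "\<lambda>u. int (\<theta> u) * u"] split[of "\<lambda>u. int (\<eta> u) * u"] rest[of "\<lambda>u n. int n * u"] \<theta>_y \<theta>_z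
      using z1 by (simp add: algebra_simps of_nat_diff)
    moreover have "spread \<theta> = spread \<eta> + a y - a z - 2"
      unfolding split[of "\<lambda>u. int (\<theta> u) * (int (k u) - int (\<theta> u))"] split[of "\<lambda>u. int (\<eta> u) * (int (k u) - int (\<eta> u))"]
        rest[of "\<lambda>u n. int n * (int (k u) - int n)"] \<theta>_y \<theta>_z a_def
      using z1 by (simp add: algebra_simps of_nat_diff)
    ultimately have "1 + spread \<theta> \<le> int (f ((s + y - z) mod q))" "spread \<theta> = spread \<eta> + a y - a z - 2"
      using fibre[OF \<theta>_le \<theta>_sum] by simp_all
    moreover have "0 \<le> spread \<theta>" using \<theta>_le by (rule spread_nonneg)
    ultimately show ?thesis by linarith
  qed
  have centre: "1 + spread \<eta> \<le> int (f (s mod q))"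
    using fibre[of \<eta>] \<eta> h by (force simp: s_def)
  have "0 \<le> spread \<eta>" using \<eta> by (intro spread_nonneg) force
  have pos: "1 \<le> f ((s + y - z) mod q)" if "y \<in> D" "z \<in> D" for y z
    using swap[OF that] centre \<open>0 \<le> spread \<eta>\<close> by (cases "y = z") auto
  \<comment> \<open>With \<open>a z\<close> least, swapping against \<open>z\<close> lowers the
    spread by at most two.\<close>
  obtain z where z: "z \<in> D" "\<And>y. y \<in> D \<Longrightarrow> a z \<le> a y"
  proof -
    have "Min (a ` D) \<in> a ` D" using finite_D \<open>D \<noteq> {}\<close> by (intro Min_in) auto
    then obtain z where "z \<in> D" "a z = Min (a ` D)" by auto
    moreover from this have "a z \<le> a y" if "y \<in> D" for y using that finite_D by simp
    ultimately show ?thesis using that by blast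
  qed
  have near: "spread \<eta> - 1 \<le> int (f ((s + y - z) mod q))" if "y \<in> D" for y
    using swap[OF that z(1)] z(2)[OF that] centre by (cases "y = z") auto
  obtain x where bij: "bij_betw x {..<card D} D"
    using ex_bij_betw_nat_finite[OF finite_D] by (auto simp: atLeast0LessThan)
  have xD: "i < d \<Longrightarrow> x i \<in> D" for i using bij by (auto simp: bij_betw_def d_def)
  \<comment> \<open>Cauchy--Davenport needs \<open>d - 1 + b < q\<close>, so the range of subtracted
    residues is cut off at \<open>q - d\<close> when \<open>D\<close> is large.\<close>
  define b where "b = min (d - 1) (nat q - d)"
  define Y2 where "Y2 = (\<lambda>y. (s + y) mod q) ` {(x i + - x j) mod q |i j. i \<le> d - 1 \<and> j \<le> b}"
  have dq: "int d \<le> q" using card_D_le by (simp add: d_def)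
  then have bq: "int (d - 1 + b) < q" using d by (simp add: b_def)
  have Y2: "Y2 \<subseteq> {0..<q}" using q_pos by (auto simp: Y2_def)
  have cardY2: "d - 1 + b < card Y2"
  proof -
    have "\<not> [- x i = - x j] (mod q)" if "i < j" "j < card D" for i j
      using not_cong_on_D[OF bij that] by (simp add: cong_minus_minus_iff)
    then have "d - 1 + b < card {(x i + - x j) mod q |i j. i \<le> d - 1 \<and> j \<le> b}"
      using not_cong_on_D[OF bij] d bq
      by (intro cauchy_davenport_mod_prime[OF q]) (auto simp: b_def d_def)
    moreover have "{(x i + - x j) mod q |i j. i \<le> d - 1 \<and> j \<le> b} \<subseteq> {0..<q}"
      using q_pos by auto
    ultimately show ?thesis
      unfolding Y2_def using card_add_mod_image by simp
  qed
  have fY2: "1 \<le> f y" if "y \<in> Y2" for y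
  proof -
    obtain i j where ij: "i \<le> d - 1" "j \<le> b" and "y = (s + (x i + - x j) mod q) mod q"
      using \<open>y \<in> Y2\<close> unfolding Y2_def by blast
    then have "y = (s + x i - x j) mod q" by (simp add: mod_simps algebra_simps)
    moreover have "x i \<in> D" "x j \<in> D" using xD ij d by (auto simp: b_def)
    ultimately show ?thesis using pos by simp
  qed
  show ?thesis
  proof (cases "2 * int d - 2 < q")
    case False
    then have "q \<le> int (card Y2)" using cardY2 d dq by (auto simp: b_def)
    then show ?thesis using full_support_bound[OF Y2 fY2] by linarith
  next
    case True
    then have b: "b = d - 1" using d dq by (auto simp: b_def)
    \<comment> \<open>The centre gives \<open>1 + spread \<eta>\<close>, the next
      \<open>d - 1\<close> representatives come from swaps with \<open>z\<close> and give
      \<open>spread \<eta> - 1\<close>, and the last \<open>d - 1\<close> are arbitrary elements of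
      \<open>Y2\<close> giving 1. The total is \<open>1 + d * spread \<eta>\<close>.\<close>
    define Y where "Y t = (if t = 0 then {s mod q} else if t < d then (\<lambda>y. (s - z + y) mod q) ` D else Y2)" for t
    define v where "v t = (if t = 0 then 1 + spread \<eta> else if t < d then spread \<eta> - 1 else 1)" for t
    have "(\<Sum>t\<le>2 * d - 2. v t) \<le> int (\<Sum>y\<in>{0..<q}. f y)"
    proof (rule sum_ge_by_distinct_representatives[where Y = Y])
      show "Y t \<subseteq> {0..<q}" if "t \<le> 2 * d - 2" for t
        using q_pos Y2 by (auto simp: Y_def)
      show "t < card (Y t)" if "t \<le> 2 * d - 2" for t
        using that cardY2 d card_add_mod_image[OF D] by (auto simp: Y_def b d_def)
      show "v t \<le> int (f y)" if "t \<le> 2 * d - 2" "y \<in> Y t" for t y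
        using that centre near fY2 by (fastforce simp: Y_def v_def algebra_simps split: if_splits)
    qed simp
    also have "(\<Sum>t\<le>2 * d - 2. v t) = (\<Sum>t<d + (d - 1). v t)"
      using d by (intro sum.cong) auto
    also have "\<dots> = (\<Sum>t<d. v t) + (\<Sum>t<d - 1. v (t + d))"
      by (rule sum_lessThan_add)
    also have "(\<Sum>t<d. v t) = 1 + spread \<eta> + int (d - 1) * (spread \<eta> - 1)"
    proof -
      have "(\<Sum>t<Suc (d - 1). v t) = v 0 + (\<Sum>t<d - 1. v (Suc t))"
        by (rule sum.lessThan_Suc_shift)
      also have "(\<Sum>t<d - 1. v (Suc t)) = (\<Sum>t<d - 1. spread \<eta> - 1)"
        by (rule sum.cong) (auto simp: v_def)
      finally show ?thesis using d by (simp add: v_def)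
    qed
    also have "(\<Sum>t<d - 1. v (t + d)) = int (d - 1)"
      using d by (simp add: v_def)
    also have "1 + spread \<eta> + int (d - 1) * (spread \<eta> - 1) + int (d - 1) = 1 + int d * spread \<eta>"
      using d by (simp add: of_nat_diff algebra_simps)
    finally have "1 + int d * spread \<eta> \<le> int (\<Sum>y\<in>{0..<q}. f y)" .
    moreover have "int h * (int (\<Sum>x\<in>D. k x) - int h) \<le> int d * spread \<eta>"
      using Cheb h by (simp add: d_def sum_subtractf flip: of_nat_sum)
    ultimately show ?thesis by linarith
  qed
qed

text \<open>\<open>r \<tau> x\<close> fills each residue to level \<open>\<tau>\<close>, capped at
  \<open>(k x - 1) div 2\<close>. Both \<open>r \<tau> x\<close> and \<open>k x - r \<tau> x\<close>
  grow with \<open>k x\<close>, so Chebyshev applies. Raising \<open>\<tau>\<close> by one adds at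
  most \<open>card D\<close> to the total, so some level leaves a remainder
  \<open>h - R \<tau>\<close> between 1 and \<open>card D\<close>; the value \<open>card D\<close>
  itself is handled by swaps.\<close>

lemma fibre_sum_bound:
  assumes k: "\<And>x. x \<in> D \<Longrightarrow> 1 \<le> k x" and h: "1 \<le> h" "2 * h \<le> (\<Sum>x\<in>D. k x)"
  shows "min q (1 + int h * (int (\<Sum>x\<in>D. k x) - int h)) \<le> int (\<Sum>y\<in>{0..<q}. f y)"
proof -
  define r where "r \<tau> x = min \<tau> ((k x - 1) div 2)" for \<tau> x
  define R where "R \<tau> = (\<Sum>x\<in>D. r \<tau> x)" for \<tau>
  have D_ne: "D \<noteq> {}" using h by auto
  have r2: "2 * r \<tau> x + 1 \<le> k x" if "x \<in> D" for x \<tau>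
  proof -
    have "r \<tau> x \<le> (k x - 1) div 2" by (simp add: r_def)
    then show ?thesis using k[OF that] by linarith
  qed
  have Cheb: "(\<Sum>x\<in>D. int (r \<tau> x)) * (\<Sum>x\<in>D. int (k x) - int (r \<tau> x)) \<le> int (card D) * spread (r \<tau>)" for \<tau>
  proof (rule Chebyshev_sum_product)
    fix x y
    have mono: "r \<tau> x \<le> r \<tau> y \<and> int (k x) - int (r \<tau> x) \<le> int (k y) - int (r \<tau> y)" if "k x \<le> k y" for x y
      using that unfolding r_def min_def by (auto; linarith)
    show "0 \<le> (int (r \<tau> x) - int (r \<tau> y)) * (int (k x) - int (r \<tau> x) - (int (k y) - int (r \<tau> y)))"
      using mono[of x y] mono[of y x] by (cases "k x \<le> k y") (auto intro: mult_nonneg_nonneg mult_nonpos_nonpos)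
  qed
  have perturb: ?thesis if "1 \<le> h - R \<tau>" "h - R \<tau> < card D" for \<tau>
    by (rule bound_by_subset_perturbation[where \<rho> = "r \<tau>" and g = "h - R \<tau>"]) (use that r2 Cheb in \<open>auto simp: R_def\<close>)
  have R0: "R 0 = 0" by (simp add: R_def r_def)
  show ?thesis
  proof (cases "\<exists>\<tau>. h \<le> R \<tau>")
    case False
    then have lt: "R \<tau> < h" for \<tau> by (meson not_le)
    \<comment> \<open>Large enough that only the cap counts in \<open>r \<tau>\<close>.\<close>
    define \<tau> where "\<tau> = (\<Sum>x\<in>D. k x)"
    have r_eq: "r \<tau> x = (k x - 1) div 2" if "x \<in> D" for x
    proof -
      have "k x \<le> \<tau>" unfolding \<tau>_def using that finite_D by (intro member_le_sum) auto
      then show ?thesis by (auto simp: r_def min_def)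
    qed
    have le2: "k x \<le> 2 * r \<tau> x + 2" if "x \<in> D" for x
      unfolding r_eq[OF that] by linarith
    have sum2: "(\<Sum>x\<in>D. 2 * r \<tau> x + 2) = 2 * R \<tau> + 2 * card D"
      by (simp only: sum.distrib R_def sum_distrib_left[symmetric]) simp
    have "(\<Sum>x\<in>D. k x) \<le> (\<Sum>x\<in>D. 2 * r \<tau> x + 2)"
      using le2 by (rule sum_mono)
    then have "h - R \<tau> \<le> card D" using h sum2 by linarith
    show ?thesis
    proof (cases "h - R \<tau> < card D")
      case True
      then show ?thesis using lt[of \<tau>] by (intro perturb[of \<tau>]) auto
    next
      case False
      then have hR: "h = R \<tau> + card D" using \<open>h - R \<tau> \<le> card D\<close> lt[of \<tau>] by linarith
      \<comment> \<open>The hypothesis \<open>2 * h \<le> (\<Sum>x\<in>D. k x)\<close> is now tight,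
        which forces equality at every residue: \<open>r \<tau> x + 1\<close> is half of
        \<open>k x\<close>.\<close>
      have k_eq: "k x = 2 * r \<tau> x + 2" if "x \<in> D" for x
      proof (rule ccontr)
        assume "k x \<noteq> 2 * r \<tau> x + 2"
        then have "(\<Sum>x\<in>D. k x) < (\<Sum>x\<in>D. 2 * r \<tau> x + 2)"
          using le2 that finite_D by (intro sum_strict_mono_ex1) (auto simp: order_less_le intro!: bexI[of _ x])
        then show False using hR h sum2 by linarith
      qed
      show ?thesis
      proof (rule bound_by_swaps[where \<eta> = "\<lambda>x. r \<tau> x + 1"])
        show "(\<Sum>x\<in>D. r \<tau> x + 1) = h" using hR by (simp only: sum.distrib R_def) simp
        show "(\<Sum>x\<in>D. int (r \<tau> x + 1)) * (\<Sum>x\<in>D. int (k x) - int (r \<tau> x + 1)) \<le> int (card D) * spread (\<lambda>x. r \<tau> x + 1)"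
        proof (rule Chebyshev_sum_product)
          have eq: "int (k x) - int (r \<tau> x + 1) = int (r \<tau> x + 1)" if "x \<in> D" for x
            by (simp add: k_eq[OF that])
          fix x y assume "x \<in> D" "y \<in> D"
          then show "0 \<le> (int (r \<tau> x + 1) - int (r \<tau> y + 1))
              * (int (k x) - int (r \<tau> x + 1) - (int (k y) - int (r \<tau> y + 1)))"
            by (simp only: eq zero_le_square)
        qed
      qed (use k_eq D_ne in auto)
    qed
  next
    case True
    \<comment> \<open>The first level reaching \<open>h\<close>; it is positive because
      \<open>R 0 = 0 < h\<close>, and the level below it is used.\<close>
    define \<sigma> where "\<sigma> = (LEAST \<tau>. h \<le> R \<tau>)"
    have \<sigma>: "h \<le> R \<sigma>" unfolding \<sigma>_def using True by (rule LeastI_ex)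
    then obtain \<tau> where \<tau>: "\<sigma> = Suc \<tau>" using R0 h by (cases \<sigma>) auto
    have \<sigma>: "h \<le> R (Suc \<tau>)" using \<sigma> \<tau> by simp
    from \<tau> have lt: "R \<tau> < h" using not_less_Least[of \<tau> "\<lambda>\<tau>. h \<le> R \<tau>"] by (auto simp: \<sigma>_def)
    have r_Suc: "r (Suc \<tau>) x \<le> r \<tau> x + 1" for x by (auto simp: r_def)
    have sum1: "(\<Sum>x\<in>D. r \<tau> x + 1) = R \<tau> + card D" by (simp only: sum.distrib R_def) simp
    have "R (Suc \<tau>) \<le> R \<tau> + card D"
      unfolding sum1[symmetric] R_def[of "Suc \<tau>"] using r_Suc by (rule sum_mono)
    then have "h - R \<tau> \<le> card D" using \<sigma> by linarith
    show ?thesis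
    proof (cases "h - R \<tau> < card D")
      case True
      then show ?thesis using lt by (intro perturb[of \<tau>]) auto
    next
      case False
      then have hR: "h = R (Suc \<tau>)" "R (Suc \<tau>) = R \<tau> + card D"
        using \<open>h - R \<tau> \<le> card D\<close> lt \<sigma> \<open>R (Suc \<tau>) \<le> R \<tau> + card D\<close> by linarith+
      \<comment> \<open>The total grew by \<open>card D\<close>, the largest possible amount, so
        every residue gained one; in particular \<open>r (Suc \<tau>)\<close> is positive on
        \<open>D\<close>.\<close>
      have r_eq: "r (Suc \<tau>) x = r \<tau> x + 1" if "x \<in> D" for x
      proof (rule ccontr)
        assume "r (Suc \<tau>) x \<noteq> r \<tau> x + 1"
        then have "R (Suc \<tau>) < (\<Sum>x\<in>D. r \<tau> x + 1)"
          unfolding R_def using r_Suc that finite_D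
          by (intro sum_strict_mono_ex1) (auto simp: order_less_le intro!: bexI[of _ x])
        then show False using hR sum1 by linarith
      qed
      show ?thesis
      proof (rule bound_by_swaps[where \<eta> = "r (Suc \<tau>)"])
        show "1 \<le> r (Suc \<tau>) x \<and> r (Suc \<tau>) x < k x" if "x \<in> D" for x
          using r_eq[OF that] r2[OF that, of "Suc \<tau>"] by linarith
      qed (use hR D_ne Cheb in \<open>auto simp: R_def\<close>)
    qed
  qed
qed

end

section \<open>Finite abelian groups\<close>

definition nat_multiple :: "nat \<Rightarrow> 'a::ab_group_add \<Rightarrow> 'a" where
  "nat_multiple n x = (\<Sum>i<n. x)"

lemma nat_multiple_0 [simp]: "nat_multiple 0 x = 0"
  and nat_multiple_Suc [simp]: "nat_multiple (Suc n) x = x + nat_multiple n x"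
  by (simp_all add: nat_multiple_def add.commute)

lemma nat_multiple_add: "nat_multiple (m + n) x = nat_multiple m x + nat_multiple n x"
  by (induction m) (simp_all add: add.assoc)

lemma nat_multiple_mult: "nat_multiple (m * n) x = nat_multiple m (nat_multiple n x)"
  by (induction m) (simp_all add: nat_multiple_add)

lemma nat_multiple_distrib: "nat_multiple n (x + y) = nat_multiple n x + nat_multiple n y"
  by (simp add: nat_multiple_def sum.distrib)

lemma sum_const_nat_multiple: "finite S \<Longrightarrow> (\<Sum>s\<in>S. x) = nat_multiple (card S) x"
  by (induction S rule: finite_induct) simp_all

lemma ex_nat_multiple_eq_0:
  fixes x :: "'a::{finite,ab_group_add}"
  shows "\<exists>n>0. nat_multiple n x = 0"
proof -
  have "\<not> inj (\<lambda>n. nat_multiple n x)"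
    using finite_imageD[of "\<lambda>n. nat_multiple n x" UNIV] by auto
  then obtain m n where "m < n" "nat_multiple m x = nat_multiple n x"
    unfolding inj_def by (metis linorder_neqE_nat)
  then have "n - m > 0" "nat_multiple (n - m) x = 0"
    using nat_multiple_add[of m "n - m" x] by auto
  then show ?thesis by blast
qed

lemma add_subgroup_nat_multiple:
  assumes "add_subgroup H" "x \<in> H"
  shows "nat_multiple n x \<in> H"
  using assms by (induction n) (auto simp: add_subgroup_def)

lemma add_subgroup_diff:
  assumes "add_subgroup H" "x \<in> H" "y \<in> H"
  shows "x - y \<in> H"
  using assms unfolding add_subgroup_def by (metis add_uminus_conv_diff)

lemma add_subgroup_add:
  assumes "add_subgroup H" "x \<in> H" "y \<in> H"
  shows "x + y \<in> H"
  using assms unfolding add_subgroup_def by blast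

text \<open>In a finite group \<open>- x\<close> is itself a natural multiple of
  \<open>x\<close>.\<close>

lemma add_subgroup_finiteI:
  fixes H :: "'a::{finite,ab_group_add} set"
  assumes "0 \<in> H" and add: "\<And>x y. x \<in> H \<Longrightarrow> y \<in> H \<Longrightarrow> x + y \<in> H"
  shows "add_subgroup H"
proof -
  have mult: "nat_multiple n x \<in> H" if "x \<in> H" for n x
    using assms that by (induction n) auto
  have "- x \<in> H" if "x \<in> H" for x
  proof -
    obtain n where "n > 0" "nat_multiple n x = 0" using ex_nat_multiple_eq_0 by blast
    then have "x + nat_multiple (n - 1) x = 0" by (cases n) auto
    then have "- x = nat_multiple (n - 1) x" by (simp add: minus_unique)
    then show ?thesis using mult that by simp
  qed
  then show ?thesis using assms by (auto simp: add_subgroup_def)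
qed

lemma min_subgroup_order_le:
  fixes H :: "'a::{finite,ab_group_add} set"
  assumes "add_subgroup H" "H \<noteq> {0}"
  shows "min_subgroup_order TYPE('a) \<le> card H"
proof -
  have "finite {card H |H :: 'a set. add_subgroup H \<and> H \<noteq> {0}}"
    unfolding setcompr_eq_image by simp
  then show ?thesis
    unfolding min_subgroup_order_def using assms by (intro Min_le) auto
qed

section \<open>Cauchy--Davenport in finite abelian groups\<close>

lemma cauchy_davenport_group:
  fixes A B :: "'a::{finite,ab_group_add} set"
  assumes "A \<noteq> {}" "B \<noteq> {}"
  shows "min (min_subgroup_order TYPE('a)) (card A + card B - 1) \<le> card (A + B)"
  using assms
proof (induction "card B" arbitrary: A B rule: less_induct)
  case less
  obtain b where b: "b \<in> B" using less.prems by blast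
  have "(\<lambda>a. a + b) ` A \<subseteq> A + B" using b by (auto intro: set_plus_intro)
  then have card_le: "card A \<le> card (A + B)"
    using card_mono[of "A + B" "(\<lambda>a. a + b) ` A"] by (simp add: card_image)
  \<comment> \<open>Either a Dyson transform shrinks \<open>B\<close>, or \<open>A\<close> is stable under the nonzero differences of \<open>B\<close>.\<close>
  show ?case
  proof (cases "\<exists>a\<in>A. \<exists>c\<in>B. \<exists>d\<in>B. a + d - c \<notin> A")
    case True
    then obtain a c d where acd: "a \<in> A" "c \<in> B" "d \<in> B" "a + d - c \<notin> A" by blast
    \<comment> \<open>This shift keeps \<open>c\<close> in \<open>B'\<close>, since
      \<open>c + e = a\<close>, and expels \<open>d\<close>, since \<open>d + e\<close> is not in
      \<open>A\<close>.\<close>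
    define e where "e = a - c"
    define A' where "A' = A \<union> (\<lambda>y. y + e) ` B"
    define B' where "B' = {y \<in> B. y + e \<in> A}"
    have B': "c \<in> B'" "d \<notin> B'" "B' \<subseteq> B" using acd by (auto simp: B'_def e_def algebra_simps)
    have "card B' < card B" using B' acd by (intro psubset_card_mono) auto
    moreover have "A' \<noteq> {}" "B' \<noteq> {}" using acd B' by (auto simp: A'_def)
    ultimately have "min (min_subgroup_order TYPE('a)) (card A' + card B' - 1) \<le> card (A' + B')"
      by (rule less.hyps)
    moreover have "A' + B' \<subseteq> A + B"
    proof
      fix z assume "z \<in> A' + B'"
      then obtain x y where xy: "x \<in> A'" "y \<in> B'" "z = x + y" by (auto elim: set_plus_elim)
      show "z \<in> A + B"
      proof (cases "x \<in> A")
        case True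
        then show ?thesis using xy B' by (auto intro: set_plus_intro)
      next
        case False
        then obtain u where "u \<in> B" "x = u + e" using xy by (auto simp: A'_def)
        then have "z = (y + e) + u" using xy by (simp add: algebra_simps)
        moreover have "y + e \<in> A" using xy by (simp add: B'_def)
        ultimately show ?thesis using set_plus_intro[OF _ \<open>u \<in> B\<close>] by blast
      qed
    qed
    moreover have "card A' + card B' = card A + card B"
    proof -
      have img: "card ((\<lambda>y. y + e) ` X) = card X" for X :: "'a set" by (simp add: card_image)
      have "A \<inter> (\<lambda>y. y + e) ` B = (\<lambda>y. y + e) ` B'" by (auto simp: B'_def)
      then have "card B' = card (A \<inter> (\<lambda>y. y + e) ` B)" by (simp add: img)
      then show ?thesis
        unfolding A'_def using card_Un_Int[of A "(\<lambda>y. y + e) ` B"] by (simp add: img)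
    qed
    ultimately show ?thesis
      using card_mono[of "A + B" "A' + B'"] by simp
  next
    case False
    show ?thesis
    proof (cases "B = {b}")
      case True
      then show ?thesis using card_le by simp
    next
      case neq: False
      then obtain d where d: "d \<in> B" "d \<noteq> b" using b by blast
      \<comment> \<open>The stabiliser of \<open>A\<close>: it contains \<open>d - b\<close>, and
        \<open>A\<close> contains a translate of it, so \<open>A\<close> alone has at least
        \<open>p(G)\<close> elements.\<close>
      define H where "H = {x. \<forall>a\<in>A. a + x \<in> A}"
      have "add_subgroup H"
        by (rule add_subgroup_finiteI) (auto simp: H_def add.assoc[symmetric])
      moreover have "d - b \<in> H" using False b d by (auto simp: H_def add_diff_eq)
      ultimately have "min_subgroup_order TYPE('a) \<le> card H"
        using d by (intro min_subgroup_order_le) auto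
      moreover obtain a where "a \<in> A" using less.prems by blast
      then have "(+) a ` H \<subseteq> A" by (auto simp: H_def)
      then have "card H \<le> card A" using card_mono[of A "(+) a ` H"] by (simp add: card_image)
      ultimately show ?thesis using card_le by linarith
    qed
  qed
qed

text \<open>Cauchy--Davenport makes the size minus one superadditive until \<open>p(G)\<close> is
  reached; nonemptiness is carried along for the induction.\<close>

lemma card_sum_sets_ge:
  fixes S :: "'i \<Rightarrow> 'a::{finite,ab_group_add} set"
  assumes "finite I" "\<And>i. i \<in> I \<Longrightarrow> S i \<noteq> {}"
    and "\<And>i. i \<in> I \<Longrightarrow> min (min_subgroup_order TYPE('a)) (1 + n i) \<le> card (S i)"
  shows "(\<Sum>i\<in>I. S i) \<noteq> {} \<and> min (min_subgroup_order TYPE('a)) (1 + (\<Sum>i\<in>I. n i)) \<le> card (\<Sum>i\<in>I. S i)"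
  using assms
proof (induction I rule: finite_induct)
  case empty
  then show ?case by simp
next
  case (insert i I)
  let ?p = "min_subgroup_order TYPE('a)" and ?R = "\<Sum>i\<in>I. S i"
  have R: "?R \<noteq> {}" "min ?p (1 + (\<Sum>i\<in>I. n i)) \<le> card ?R" using insert by auto
  have Si: "S i \<noteq> {}" "min ?p (1 + n i) \<le> card (S i)" using insert.prems by auto
  have eq: "(\<Sum>i\<in>insert i I. S i) = S i + ?R" using insert by simp
  have "card (S i) \<ge> 1" "card ?R \<ge> 1" using R Si by (simp_all add: Suc_le_eq card_gt_0_iff)
  then have "min ?p (1 + (\<Sum>i\<in>insert i I. n i)) \<le> min ?p (card (S i) + card ?R - 1)"
    using R(2) Si(2) unfolding sum.insert[OF insert.hyps] by linarith
  also have "\<dots> \<le> card (S i + ?R)" using R Si by (intro cauchy_davenport_group)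
  finally show ?case
    unfolding eq using R(1) Si(1) by (auto simp: set_plus_def)
qed

text \<open>\<open>K\<close> is a maximal proper subgroup of \<open>H\<close>, \<open>g\<close> lies
  outside it, and \<open>\<phi> x\<close> is the \<open>n < q\<close> for which \<open>x\<close>
  lies in the coset of the \<open>n\<close>-th multiple of \<open>g\<close>.\<close>

lemma prime_index_subgroup:
  fixes H :: "'a::{finite,ab_group_add} set"
  assumes H: "add_subgroup H" "H \<noteq> {0}"
  obtains K and q :: nat and \<phi> :: "'a \<Rightarrow> nat" where "add_subgroup K" "K \<subset> H" "prime q"
    "min_subgroup_order TYPE('a) \<le> q" "\<And>x. x \<in> H \<Longrightarrow> \<phi> x < q"
    "\<And>x y. x \<in> H \<Longrightarrow> y \<in> H \<Longrightarrow> \<phi> (x + y) = (\<phi> x + \<phi> y) mod q"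
    "\<And>x. x \<in> H \<Longrightarrow> \<phi> x = 0 \<Longrightarrow> x \<in> K"
proof -
  let ?\<K> = "{K. add_subgroup K \<and> K \<subset> H}"
  have "{0} \<in> ?\<K>" using H by (auto simp: add_subgroup_def)
  then obtain K where K: "add_subgroup K" "K \<subset> H" and max: "\<And>L. add_subgroup L \<Longrightarrow> L \<subset> H \<Longrightarrow> K \<subseteq> L \<Longrightarrow> L = K"
    using finite_has_maximal[of ?\<K>] by (metis (mono_tags, lifting) empty_iff finite mem_Collect_eq)
  note K_closed = add_subgroup_add[OF K(1)] add_subgroup_diff[OF K(1)] add_subgroup_nat_multiple[OF K(1)]
  note H_closed = add_subgroup_add[OF H(1)] add_subgroup_diff[OF H(1)] add_subgroup_nat_multiple[OF H(1)]
  have K0: "0 \<in> K" using K by (simp add: add_subgroup_def)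
  obtain g where g: "g \<in> H" "g \<notin> K" using K by blast
  have generate: "\<exists>k\<in>K. \<exists>n. x = k + nat_multiple n u" if u: "u \<in> H" "u \<notin> K" and x: "x \<in> H" for u x
  proof -
    let ?L = "{k + nat_multiple n u |k n. k \<in> K}"
    have "add_subgroup ?L"
    proof (rule add_subgroup_finiteI)
      show "0 \<in> ?L" using K0 by (auto intro!: exI[of _ 0])
      fix x y assume "x \<in> ?L" "y \<in> ?L"
      then obtain k m l n where "x = k + nat_multiple m u" "y = l + nat_multiple n u" "k \<in> K" "l \<in> K" by blast
      then have "x + y = (k + l) + nat_multiple (m + n) u" "k + l \<in> K"
        using K_closed by (auto simp: nat_multiple_add algebra_simps)
      then show "x + y \<in> ?L" by blast
    qed
    moreover have "K \<subseteq> ?L"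
    proof
      fix k assume "k \<in> K"
      moreover have "k = k + nat_multiple 0 u" by simp
      ultimately show "k \<in> ?L" by blast
    qed
    moreover have "u \<in> ?L"
    proof -
      have "u = 0 + nat_multiple 1 u" by simp
      then show ?thesis using K0 by blast
    qed
    moreover have "?L \<subseteq> H" using K u H_closed by auto
    ultimately have "?L = H" using max[of ?L] u by blast
    then show ?thesis using x by blast
  qed
  define q where "q = (LEAST n. 0 < n \<and> nat_multiple n g \<in> K)"
  have "\<exists>n. 0 < n \<and> nat_multiple n g \<in> K"
    using ex_nat_multiple_eq_0[of g] K0 by metis
  then have q: "0 < q" "nat_multiple q g \<in> K"
    unfolding q_def by (metis (mono_tags, lifting) LeastI_ex)+
  have q_least: "nat_multiple n g \<notin> K" if "0 < n" "n < q" for n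
    using that not_less_Least unfolding q_def by blast
  have mod_q: "nat_multiple n g - nat_multiple (n mod q) g \<in> K" for n
  proof -
    have "nat_multiple n g = nat_multiple (n div q) (nat_multiple q g) + nat_multiple (n mod q) g"
      by (metis div_mult_mod_eq nat_multiple_add nat_multiple_mult)
    then show ?thesis using q K_closed by simp
  qed
  have "1 < q" using q g by (cases "q = 1") auto
  \<comment> \<open>If \<open>q = a * b\<close>, the \<open>a\<close>-th multiple of
    \<open>g\<close> is outside \<open>K\<close>, so by maximality it generates \<open>H\<close>
    together with \<open>K\<close>. Multiplying the resulting expression for \<open>g\<close> by
    \<open>b\<close> puts the \<open>b\<close>-th multiple of \<open>g\<close> into
    \<open>K\<close>, against the minimality of \<open>q\<close>.\<close>
  have "prime q"
  proof (rule ccontr)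
    assume "\<not> prime q"
    then obtain a b where ab: "q = a * b" "1 < a" "a < q" "1 < b" "b < q"
    proof -
      from \<open>\<not> prime q\<close> \<open>1 < q\<close> obtain a where a: "a dvd q" "a \<noteq> 1" "a \<noteq> q"
        by (auto simp: prime_nat_iff)
      then obtain b where b: "q = a * b" by blast
      have "1 < a" "1 < b" using a b \<open>1 < q\<close> by (cases a; cases b; auto)+
      then have "a < q" "b < q" using b by auto
      then show ?thesis using that b \<open>1 < a\<close> \<open>1 < b\<close> by blast
    qed
    then have "nat_multiple a g \<in> H" "nat_multiple a g \<notin> K" using g q_least H_closed by auto
    from generate[OF this g(1)] obtain k n where k: "k \<in> K" "g = k + nat_multiple n (nat_multiple a g)"
      by blast
    have "nat_multiple b g = nat_multiple b k + nat_multiple (b * (n * a)) g"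
      by (subst k(2)) (simp only: nat_multiple_distrib nat_multiple_mult)
    also have "b * (n * a) = n * q" by (simp add: ab)
    finally have "nat_multiple b g \<in> K"
      using k q K_closed by (simp add: nat_multiple_mult)
    then show False using q_least[of b] ab by simp
  qed
  moreover have "min_subgroup_order TYPE('a) \<le> q"
  proof -
    \<comment> \<open>The order \<open>N\<close> of \<open>g\<close> is a multiple
      \<open>q * t\<close>, because 0 lies in \<open>K\<close>. Hence the \<open>t\<close>-th
      multiple \<open>u\<close> of \<open>g\<close> generates a nontrivial subgroup with at most
      \<open>q\<close> elements.\<close>
    define N where "N = (LEAST n. 0 < n \<and> nat_multiple n g = 0)"
    have N: "0 < N" "nat_multiple N g = 0"
      using ex_nat_multiple_eq_0[of g] unfolding N_def by (metis (mono_tags, lifting) LeastI_ex)+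
    have N_least: "nat_multiple n g \<noteq> 0" if "0 < n" "n < N" for n
      using that not_less_Least unfolding N_def by blast
    have "nat_multiple (N mod q) g \<in> K"
      using mod_q[of N] N K K0 add_subgroup_diff[OF K(1) K0] by fastforce
    then have "N mod q = 0" using q_least[of "N mod q"] q by auto
    then obtain t where t: "N = q * t" by auto
    define u where "u = nat_multiple t g"
    have "0 < t" "t < N" using N t \<open>1 < q\<close> by auto
    then have "u \<noteq> 0" using N_least by (simp add: u_def)
    have u: "nat_multiple q u = 0" using N t by (simp add: u_def nat_multiple_mult)
    let ?U = "(\<lambda>i. nat_multiple i u) ` {..<q}"
    have U: "nat_multiple i u \<in> ?U" for i
    proof -
      have "nat_multiple i u = nat_multiple (i div q) (nat_multiple q u) + nat_multiple (i mod q) u"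
        by (metis div_mult_mod_eq nat_multiple_add nat_multiple_mult)
      also have "nat_multiple (i div q) (nat_multiple q u) = 0"
        unfolding u by (simp add: nat_multiple_def)
      finally show ?thesis using q by auto
    qed
    have "add_subgroup ?U"
      by (rule add_subgroup_finiteI) (use U[of 0] U in \<open>auto simp flip: nat_multiple_add\<close>)
    moreover have "u \<in> ?U" using U[of 1] by simp
    ultimately have "min_subgroup_order TYPE('a) \<le> card ?U"
      using \<open>u \<noteq> 0\<close> by (intro min_subgroup_order_le) auto
    also have "\<dots> \<le> q" using card_image_le[of "{..<q}"] by simp
    finally show ?thesis .
  qed
  moreover have ex: "\<exists>n<q. x - nat_multiple n g \<in> K" if "x \<in> H" for x
  proof -
    obtain k n where "k \<in> K" "x = k + nat_multiple n g" using generate[OF g \<open>x \<in> H\<close>] by blast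
    then have "x - nat_multiple (n mod q) g = k + (nat_multiple n g - nat_multiple (n mod q) g)" by simp
    then have "x - nat_multiple (n mod q) g \<in> K" using mod_q \<open>k \<in> K\<close> K_closed by metis
    then show ?thesis using q by (intro exI[of _ "n mod q"]) simp
  qed
  have unique: "m = n" if "m < q" "n < q" "x - nat_multiple m g \<in> K" "x - nat_multiple n g \<in> K" for m n x
  proof -
    have False if "m < n" "n < q" "x - nat_multiple m g \<in> K" "x - nat_multiple n g \<in> K" for m n
    proof -
      have "nat_multiple (n - m) g = (x - nat_multiple m g) - (x - nat_multiple n g)"
        using nat_multiple_add[of m "n - m" g] that by (simp add: algebra_simps)
      then have "nat_multiple (n - m) g \<in> K" using K_closed(2)[OF that(3,4)] by (simp only:)
      then show False using q_least[of "n - m"] that by simp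
    qed
    then show ?thesis using that by (metis linorder_neqE_nat)
  qed
  define \<phi> where "\<phi> x = (SOME n. n < q \<and> x - nat_multiple n g \<in> K)" for x
  have \<phi>: "\<phi> x < q" "x - nat_multiple (\<phi> x) g \<in> K" if "x \<in> H" for x
    using someI_ex[OF ex[OF that, unfolded Bex_def]] by (simp_all add: \<phi>_def)
  moreover have "\<phi> (x + y) = (\<phi> x + \<phi> y) mod q" if xy: "x \<in> H" "y \<in> H" for x y
  proof (rule unique[of _ _ "x + y"])
    have "x + y - nat_multiple ((\<phi> x + \<phi> y) mod q) g
      = ((x - nat_multiple (\<phi> x) g) + (y - nat_multiple (\<phi> y) g))
        + (nat_multiple (\<phi> x + \<phi> y) g - nat_multiple ((\<phi> x + \<phi> y) mod q) g)"
      by (simp add: nat_multiple_add algebra_simps)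
    also have "\<dots> \<in> K" using \<phi>(2) xy mod_q by (intro K_closed(1))
    finally show "x + y - nat_multiple ((\<phi> x + \<phi> y) mod q) g \<in> K" .
  qed (use \<phi> xy H_closed q in auto)
  moreover have "x \<in> K" if "x \<in> H" "\<phi> x = 0" for x using \<phi>(2)[OF that(1)] that by simp
  ultimately show ?thesis using that K by blast
qed

section \<open>Sums of distinct elements\<close>

definition restricted_sumset :: "nat \<Rightarrow> 'a::ab_group_add set \<Rightarrow> 'a set" where
  "restricted_sumset h B = {\<Sum>S |S. S \<subseteq> B \<and> card S = h}"

lemma restricted_sumset_nonempty:
  assumes "h \<le> card B"
  shows "restricted_sumset h B \<noteq> {}"
proof -
  obtain S where "S \<subseteq> B" "card S = h" using obtain_subset_with_card_n[OF assms] by metis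
  then show ?thesis by (auto simp: restricted_sumset_def)
qed

text \<open>Every sum of \<open>h\<close> elements moves by the same \<open>h\<close>-fold multiple
  of \<open>c\<close>.\<close>

lemma card_restricted_sumset_translate:
  fixes B :: "'a::{finite,ab_group_add} set"
  shows "card (restricted_sumset h ((+) c ` B)) = card (restricted_sumset h B)"
proof -
  have sum: "\<Sum>((+) c ` S) = nat_multiple (card S) c + \<Sum>S" for S
    by (simp add: sum.reindex sum.distrib sum_const_nat_multiple)
  have "restricted_sumset h ((+) c ` B) = (+) (nat_multiple h c) ` restricted_sumset h B"
  proof
    show "restricted_sumset h ((+) c ` B) \<subseteq> (+) (nat_multiple h c) ` restricted_sumset h B"
    proof
      fix z assume "z \<in> restricted_sumset h ((+) c ` B)"
      then obtain S where S: "S \<subseteq> (+) c ` B" "card S = h" "z = \<Sum>S"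
        by (auto simp: restricted_sumset_def)
      then obtain S' where "S' \<subseteq> B" "S = (+) c ` S'" by (auto simp: subset_image_iff)
      then show "z \<in> (+) (nat_multiple h c) ` restricted_sumset h B"
        using S sum[of S'] by (auto simp: restricted_sumset_def card_image)
    qed
    show "(+) (nat_multiple h c) ` restricted_sumset h B \<subseteq> restricted_sumset h ((+) c ` B)"
    proof
      fix z assume "z \<in> (+) (nat_multiple h c) ` restricted_sumset h B"
      then obtain S where S: "S \<subseteq> B" "card S = h" "z = nat_multiple h c + \<Sum>S"
        by (auto simp: restricted_sumset_def)
      then have "z = \<Sum>((+) c ` S)" "(+) c ` S \<subseteq> (+) c ` B" "card ((+) c ` S) = h"
        using sum[of S] by (auto simp: card_image)
      then show "z \<in> restricted_sumset h ((+) c ` B)" by (auto simp: restricted_sumset_def)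
    qed
  qed
  then show ?thesis by (simp add: card_image)
qed

text \<open>Passing to complements in \<open>B\<close> reflects sums about \<open>\<Sum>B\<close>.
  This reduces the main inequality to \<open>2 * h \<le> card B\<close>.\<close>

lemma card_restricted_sumset_complement:
  fixes B :: "'a::{finite,ab_group_add} set"
  assumes "h \<le> card B"
  shows "card (restricted_sumset (card B - h) B) \<le> card (restricted_sumset h B)"
proof -
  have "restricted_sumset (card B - h) B \<subseteq> (\<lambda>z. \<Sum>B - z) ` restricted_sumset h B"
  proof
    fix z assume "z \<in> restricted_sumset (card B - h) B"
    then obtain S where S: "S \<subseteq> B" "card S = card B - h" "z = \<Sum>S"
      by (auto simp: restricted_sumset_def)
    then have "card (B - S) = h" using assms by (simp add: card_Diff_subset)
    then have "\<Sum>(B - S) \<in> restricted_sumset h B" by (auto simp: restricted_sumset_def)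
    moreover have "z = \<Sum>B - \<Sum>(B - S)" using S by (simp add: sum_diff)
    ultimately show "z \<in> (\<lambda>z. \<Sum>B - z) ` restricted_sumset h B" by blast
  qed
  then show ?thesis by (rule surj_card_le[OF finite])
qed

text \<open>Sets chosen in disjoint fibres do not overlap, so their union realises the sum of their
  sums and meets each fibre in its own part.\<close>

lemma sum_restricted_sumsets_subset:
  fixes F :: "'i \<Rightarrow> 'a::{finite,ab_group_add} set"
  assumes "finite D" and disj: "\<And>x y. x \<in> D \<Longrightarrow> y \<in> D \<Longrightarrow> x \<noteq> y \<Longrightarrow> F x \<inter> F y = {}"
  shows "(\<Sum>x\<in>D. restricted_sumset (\<eta> x) (F x)) \<subseteq>
    {\<Sum>S |S. S \<subseteq> (\<Union>x\<in>D. F x) \<and> (\<forall>x\<in>D. card (S \<inter> F x) = \<eta> x)}"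
proof
  fix z assume "z \<in> (\<Sum>x\<in>D. restricted_sumset (\<eta> x) (F x))"
  then obtain s where s: "\<And>x. x \<in> D \<Longrightarrow> s x \<in> restricted_sumset (\<eta> x) (F x)" "z = (\<Sum>x\<in>D. s x)"
    using \<open>finite D\<close> by (auto simp: set_sum_alt)
  then have "\<forall>x\<in>D. \<exists>S. S \<subseteq> F x \<and> card S = \<eta> x \<and> s x = \<Sum>S" by (auto simp: restricted_sumset_def)
  then obtain S where S: "\<And>x. x \<in> D \<Longrightarrow> S x \<subseteq> F x \<and> card (S x) = \<eta> x \<and> s x = \<Sum>(S x)" by metis
  have "z = \<Sum>(\<Union>x\<in>D. S x)"
    unfolding s(2) using S disj \<open>finite D\<close>
    by (subst sum.UNION_disjoint) (auto intro!: sum.cong, blast)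
  moreover have "(\<Union>x\<in>D. S x) \<inter> F x = S x" if "x \<in> D" for x
  proof
    show "(\<Union>x\<in>D. S x) \<inter> F x \<subseteq> S x"
    proof
      fix u assume "u \<in> (\<Union>x\<in>D. S x) \<inter> F x"
      then obtain y where y: "y \<in> D" "u \<in> S y" "u \<in> F x" by blast
      then have "y = x" using S[OF y(1)] disj[OF y(1) that] by blast
      then show "u \<in> S x" using y by simp
    qed
  qed (use S that in blast)
  ultimately show "z \<in> {\<Sum>S |S. S \<subseteq> (\<Union>x\<in>D. F x) \<and> (\<forall>x\<in>D. card (S \<inter> F x) = \<eta> x)}"
    using S by (auto intro!: exI[of _ "\<Union>x\<in>D. S x"])
qed

text \<open>Stated inside a subgroup so that induction on \<open>card H\<close> can pass to
  \<open>K\<close>, while \<open>min_subgroup_order\<close> stays that of the whole group.\<close>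

lemma dias_da_silva_hamidoune_subgroup:
  fixes H :: "'a::{finite,ab_group_add} set"
  assumes "add_subgroup H" "B \<subseteq> H" "h \<le> card B"
  shows "min (min_subgroup_order TYPE('a)) (1 + h * (card B - h)) \<le> card (restricted_sumset h B)"
  using assms
proof (induction "card H" arbitrary: H B h rule: less_induct)
  case less
  let ?p = "min_subgroup_order TYPE('a)"
  have half: "min ?p (1 + h * (card B - h)) \<le> card (restricted_sumset h B)" if h: "2 * h \<le> card B" for h
  proof (cases "H = {0} \<or> h = 0")
    case True
    have "card H = 1 \<or> h = 0" using True by auto
    then have "h = 0" using h card_mono[OF finite less.prems(2)] by auto
    moreover have "restricted_sumset 0 B = {0}" by (auto simp: restricted_sumset_def intro!: exI[of _ "{}"])
    ultimately show ?thesis by simp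
  next
    case False
    then obtain K and q :: nat and \<phi> :: "'a \<Rightarrow> nat" where K: "add_subgroup K" "K \<subset> H" and qp: "prime q" "?p \<le> q"
      and \<phi>: "\<And>x. x \<in> H \<Longrightarrow> \<phi> x < q" "\<And>x y. x \<in> H \<Longrightarrow> y \<in> H \<Longrightarrow> \<phi> (x + y) = (\<phi> x + \<phi> y) mod q"
        "\<And>x. x \<in> H \<Longrightarrow> \<phi> x = 0 \<Longrightarrow> x \<in> K"
      using prime_index_subgroup[OF less.prems(1)] by metis
    have H0: "0 \<in> H" using less.prems(1) by (simp add: add_subgroup_def)
    have \<phi>0: "\<phi> 0 = 0"
    proof -
      have "(0 + \<phi> 0) mod q = (\<phi> 0 + \<phi> 0) mod q" using \<phi>(1,2)[OF H0] H0 by simp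
      then have "[\<phi> 0 = 0] (mod q)"
        by (metis cong_def cong_add_rcancel_nat)
      then show ?thesis using \<phi>(1)[OF H0] by (simp add: cong_def)
    qed
    have \<phi>_sum: "\<Sum>S \<in> H \<and> \<phi> (\<Sum>S) = (\<Sum>s\<in>S. \<phi> s) mod q" if "S \<subseteq> H" for S
    proof -
      have "finite S" by simp
      then show ?thesis using that
      proof (induction S rule: finite_induct)
        case empty
        then show ?case using H0 \<phi>0 by simp
      next
        case (insert s S)
        then show ?case using \<phi>(2)[of s "\<Sum>S"] add_subgroup_add[OF less.prems(1)] by (simp add: mod_simps)
      qed
    qed
    define R where "R = restricted_sumset h B"
    define F where "F x = {b \<in> B. int (\<phi> b) = x}" for x
    define D where "D = (\<lambda>b. int (\<phi> b)) ` B"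
    define f where "f y = card {z \<in> R. int (\<phi> z) = y}" for y
    have RH: "R \<subseteq> H" using \<phi>_sum less.prems(2) by (auto simp: R_def restricted_sumset_def)
    show ?thesis
    proof (rule ccontr)
      assume "\<not> ?thesis"
      \<comment> \<open>With \<open>card R < ?p\<close>, a bound \<open>min ?p n\<close> on the size
        of a subset of \<open>R\<close> yields \<open>n\<close> itself; this supplies the bounds
        without minimum that the locale assumes.\<close>
      then have R_less: "card R < ?p" "card R < 1 + h * (card B - h)" by (auto simp: R_def)
      have D: "D \<subseteq> {0..<int q}" using \<phi>(1) less.prems(2) by (auto simp: D_def)
      have finD: "finite D" by (simp add: D_def)
      have BF: "B = (\<Union>x\<in>D. F x)" by (auto simp: D_def F_def)
      have disj: "F x \<inter> F y = {}" if "x \<noteq> y" for x y using that by (auto simp: F_def)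
      have disjD: "F x \<inter> F y = {}" if "x \<in> D" "y \<in> D" "x \<noteq> y" for x y using disj[OF that(3)] .
      interpret residue_fibres "int q" D "\<lambda>x. card (F x)" f h
      proof
        show "prime (int q)" using qp by simp
        show "D \<subseteq> {0..<int q}" by (rule D)
        fix \<eta> :: "int \<Rightarrow> nat"
        assume \<eta>: "\<And>x. x \<in> D \<Longrightarrow> \<eta> x \<le> card (F x)" and \<eta>_sum: "(\<Sum>x\<in>D. \<eta> x) = h"
        let ?Z = "\<Sum>x\<in>D. restricted_sumset (\<eta> x) (F x)" and ?y = "(\<Sum>x\<in>D. int (\<eta> x) * x) mod int q"
        have "min ?p (1 + (\<Sum>x\<in>D. \<eta> x * (card (F x) - \<eta> x))) \<le> card ?Z"
        proof (rule card_sum_sets_ge[OF finD, THEN conjunct2])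
          fix x assume x: "x \<in> D"
          then show "restricted_sumset (\<eta> x) (F x) \<noteq> {}" using \<eta> by (intro restricted_sumset_nonempty)
          \<comment> \<open>The fibre lies in a coset of \<open>K\<close>; translating by
            \<open>- c\<close> moves it into \<open>K\<close>, where the induction hypothesis
            applies.\<close>
          obtain c where c: "c \<in> B" "int (\<phi> c) = x" using x by (auto simp: D_def)
          have "(+) (- c) ` F x \<subseteq> K"
          proof
            fix u assume "u \<in> (+) (- c) ` F x"
            then obtain b where b: "b \<in> B" "\<phi> b = \<phi> c" "u = b - c" using c by (auto simp: F_def)
            then have u: "u \<in> H" using c less.prems(1,2) add_subgroup_diff by blast
            have "c \<in> H" using c less.prems(2) by blast
            then have "\<phi> (u + c) = (\<phi> u + \<phi> c) mod q" using u \<phi>(2) by blast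
            then have "(\<phi> u + \<phi> c) mod q = (0 + \<phi> c) mod q" using b \<phi>(1)[OF \<open>c \<in> H\<close>] by simp
            then have "[\<phi> u = 0] (mod q)" by (metis cong_def cong_add_rcancel_nat)
            then show "u \<in> K" using \<phi>(1,3)[OF u] by (simp add: cong_def)
          qed
          moreover have "card K < card H" using K by (simp add: psubset_card_mono)
          moreover have card: "card ((+) (- c) ` F x) = card (F x)" by (rule card_image) simp
          ultimately have "min ?p (1 + \<eta> x * (card (F x) - \<eta> x)) \<le> card (restricted_sumset (\<eta> x) ((+) (- c) ` F x))"
            using less.hyps[OF _ K(1), of "(+) (- c) ` F x" "\<eta> x"] \<eta>[OF x] by simp
          then show "min ?p (1 + \<eta> x * (card (F x) - \<eta> x)) \<le> card (restricted_sumset (\<eta> x) (F x))"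
            by (simp only: card_restricted_sumset_translate)
        qed
        moreover have sub: "?Z \<subseteq> {z \<in> R. int (\<phi> z) = ?y}"
        proof
          fix z assume "z \<in> ?Z"
          then have "z \<in> {\<Sum>S |S. S \<subseteq> (\<Union>x\<in>D. F x) \<and> (\<forall>x\<in>D. card (S \<inter> F x) = \<eta> x)}"
            by (rule subsetD[OF sum_restricted_sumsets_subset[where F = F and \<eta> = \<eta>, OF finD disjD], rotated -1])
          then obtain S where S: "S \<subseteq> B" "\<And>x. x \<in> D \<Longrightarrow> card (S \<inter> F x) = \<eta> x" "z = \<Sum>S"
            unfolding BF[symmetric] by blast
          have part: "(\<Sum>s\<in>S. G s) = (\<Sum>x\<in>D. \<Sum>s\<in>S \<inter> F x. G s)" for G :: "'a \<Rightarrow> nat"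
          proof -
            have "S = (\<Union>x\<in>D. S \<inter> F x)" using S(1) BF by blast
            then show ?thesis using finD disj by (subst \<open>S = _\<close>, subst sum.UNION_disjoint) auto
          qed
          have "card S = h" using part[of "\<lambda>_. 1"] S(2) \<eta>_sum by simp
          then have "z \<in> R" using S by (auto simp: R_def restricted_sumset_def)
          moreover have "(\<Sum>s\<in>S. int (\<phi> s)) = (\<Sum>x\<in>D. int (\<eta> x) * x)"
          proof -
            have "int (\<Sum>s\<in>S \<inter> F x. \<phi> s) = int (\<eta> x) * x" if "x \<in> D" for x
            proof -
              have "(\<Sum>s\<in>S \<inter> F x. int (\<phi> s)) = (\<Sum>s\<in>S \<inter> F x. x)" by (rule sum.cong) (auto simp: F_def)
              then show ?thesis using S(2)[OF that] by simp
            qed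
            then have "(\<Sum>x\<in>D. int (\<Sum>s\<in>S \<inter> F x. \<phi> s)) = (\<Sum>x\<in>D. int (\<eta> x) * x)"
              by (rule sum.cong[OF refl])
            moreover have "int (\<Sum>s\<in>S. \<phi> s) = (\<Sum>x\<in>D. int (\<Sum>s\<in>S \<inter> F x. \<phi> s))"
              unfolding part by (rule of_nat_sum)
            ultimately show ?thesis by simp
          qed
          moreover have "int (\<phi> z) = (\<Sum>s\<in>S. int (\<phi> s)) mod int q"
            using \<phi>_sum[of S] S less.prems(2) by (simp add: zmod_int)
          ultimately show "z \<in> {z \<in> R. int (\<phi> z) = ?y}" by simp
        qed
        have "card ?Z \<le> f ?y" unfolding f_def using sub by (intro card_mono) auto
        moreover have "f ?y \<le> card R" unfolding f_def by (intro card_mono) auto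
        ultimately have "1 + (\<Sum>x\<in>D. \<eta> x * (card (F x) - \<eta> x)) \<le> f ?y"
          using R_less by linarith
        then have "int (1 + (\<Sum>x\<in>D. \<eta> x * (card (F x) - \<eta> x))) \<le> int (f ?y)" by (rule of_nat_mono)
        also have "int (1 + (\<Sum>x\<in>D. \<eta> x * (card (F x) - \<eta> x)))
            = 1 + (\<Sum>x\<in>D. int (\<eta> x) * (int (card (F x)) - int (\<eta> x)))"
          using \<eta> by (simp add: of_nat_diff)
        finally show "1 + (\<Sum>x\<in>D. int (\<eta> x) * (int (card (F x)) - int (\<eta> x))) \<le> int (f ?y)" .
      qed
      have cardB: "(\<Sum>x\<in>D. card (F x)) = card B"
        using BF finD disj card_UN_disjoint[of D F] by simp
      have "min (int q) (1 + int h * (int (\<Sum>x\<in>D. card (F x)) - int h)) \<le> int (\<Sum>y\<in>{0..<int q}. f y)"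
      proof (rule fibre_sum_bound)
        show "1 \<le> card (F x)" if "x \<in> D" for x
          using that by (auto simp: D_def F_def Suc_le_eq card_gt_0_iff)
      qed (use False h cardB in auto)
      moreover have "(\<Sum>y\<in>{0..<int q}. f y) = card R"
      proof -
        have "R = (\<Union>y\<in>{0..<int q}. {z \<in> R. int (\<phi> z) = y})" using RH \<phi>(1) by auto
        then have "card R = card (\<Union>y\<in>{0..<int q}. {z \<in> R. int (\<phi> z) = y})" by simp
        also have "\<dots> = (\<Sum>y\<in>{0..<int q}. f y)"
          unfolding f_def by (rule card_UN_disjoint) auto
        finally show ?thesis by simp
      qed
      moreover have "int (1 + h * (card B - h)) = 1 + int h * (int (card B) - int h)"
        using h by (simp add: of_nat_diff)
      ultimately show False using R_less qp(2) unfolding cardB by linarith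
    qed
  qed
  show ?case
  proof (cases "2 * h \<le> card B")
    case True
    then show ?thesis by (rule half)
  next
    case False
    then have "min ?p (1 + (card B - h) * (card B - (card B - h))) \<le> card (restricted_sumset (card B - h) B)"
      by (intro half) simp
    also have "\<dots> \<le> card (restricted_sumset h B)"
      using less.prems(3) by (rule card_restricted_sumset_complement)
    finally show ?thesis using less.prems(3) by (simp add: mult.commute)
  qed
qed

theorem dias_da_silva_hamidoune:
  fixes B :: "'a::{finite,ab_group_add} set"
  assumes "h \<le> card B"
  shows "min (min_subgroup_order TYPE('a)) (1 + h * (card B - h)) \<le> card (restricted_sumset h B)"
  by (rule dias_da_silva_hamidoune_subgroup[of UNIV]) (use assms in \<open>auto simp: add_subgroup_def\<close>)

section \<open>From sums of distinct elements to signed sums\<close>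

text \<open>Chosen elements of \<open>A\<close> get coefficient 1, and a chosen \<open>- a\<close>
  outside \<open>A\<close> is read as coefficient -1 at \<open>a\<close>. If such a pair is chosen
  together it cancels, and a chosen 0 outside \<open>A\<close> contributes nothing, so at most
  \<open>h\<close> terms remain.\<close>

lemma restricted_sumset_subset_signed:
  fixes A :: "'a::{finite,ab_group_add} set"
  shows "restricted_sumset h (insert 0 (A \<union> uminus ` A)) \<subseteq> restricted_signed_sumset_upto h A"
proof
  fix z assume "z \<in> restricted_sumset h (insert 0 (A \<union> uminus ` A))"
  then obtain S where S: "S \<subseteq> insert 0 (A \<union> uminus ` A)" "card S = h" "z = \<Sum>S"
    by (auto simp: restricted_sumset_def)
  \<comment> \<open>The condition that \<open>- a\<close> is not in \<open>A\<close> prevents an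
    element of \<open>S\<close> from being counted twice.\<close>
  define N where "N = {a \<in> A. - a \<in> S \<and> - a \<notin> A}"
  define l :: "'a \<Rightarrow> int" where "l a = (if a \<in> S then 1 else 0) - (if a \<in> N then 1 else 0)" for a
  have ind: "(\<Sum>a\<in>A. if a \<in> T then F a else 0) = (\<Sum>a\<in>A \<inter> T. F a)" for T and F :: "'a \<Rightarrow> 'b::comm_monoid_add"
    by (simp add: sum.inter_restrict)
  have AN: "A \<inter> N = N" by (auto simp: N_def)
  have negN: "uminus ` N = S \<inter> (uminus ` A - A)" by (auto simp: N_def)
  have "(\<Sum>a\<in>A. int_multiple (l a) a) = (\<Sum>a\<in>A. (if a \<in> S then a else 0) + (if a \<in> N then - a else 0))"
    by (rule sum.cong) (auto simp: l_def)
  also have "\<dots> = \<Sum>(A \<inter> S) + (\<Sum>a\<in>N. - a)" by (simp only: sum.distrib ind AN)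
  also have "(\<Sum>a\<in>N. - a) = \<Sum>(uminus ` N)" by (simp add: sum.reindex)
  also have "\<Sum>(A \<inter> S) + \<Sum>(uminus ` N) = \<Sum>(A \<inter> S \<union> uminus ` N)"
    by (rule sum.union_disjoint[symmetric]) (auto simp: negN)
  also have "\<dots> = \<Sum>S"
    by (rule sum.mono_neutral_left) (use S(1) in \<open>auto simp: negN\<close>)
  finally have sum: "z = (\<Sum>a\<in>A. int_multiple (l a) a)" using S by simp
  define j where "j = nat (\<Sum>a\<in>A. \<bar>l a\<bar>)"
  have j: "(\<Sum>a\<in>A. \<bar>l a\<bar>) = int j" by (simp add: j_def sum_nonneg)
  have "(\<Sum>a\<in>A. \<bar>l a\<bar>) \<le> (\<Sum>a\<in>A. (if a \<in> S then 1 else 0) + (if a \<in> N then 1 else 0))"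
    by (rule sum_mono) (auto simp: l_def)
  also have "\<dots> = int (card (A \<inter> S)) + int (card (uminus ` N))"
    by (simp only: sum.distrib ind AN) (simp add: card_image)
  also have "\<dots> = int (card (A \<inter> S \<union> uminus ` N))"
    by (subst card_Un_disjoint) (auto simp: negN)
  also have "\<dots> \<le> int (card S)" using negN by (intro of_nat_mono card_mono) auto
  finally have "j \<le> h" using j S by simp
  moreover have "z \<in> restricted_signed_sumset j A"
  proof -
    have "\<forall>a\<in>A. l a \<in> {-1, 0, 1}" by (simp add: l_def)
    then show ?thesis unfolding restricted_signed_sumset_def using sum j by blast
  qed
  ultimately show "z \<in> restricted_signed_sumset_upto h A"
    by (auto simp: restricted_signed_sumset_upto_def)
qed

theorem theorem4p5:
  fixes A :: "'a::{finite, ab_group_add} set" and h m :: nat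
  assumes "CARD('a) > 1"
    and "2 \<le> h" and "h \<le> m"
    and "A \<noteq> {}" and "finite A" and "card A = m"
  shows "int (card (restricted_signed_sumset_upto h A)) \<ge>
    (if 0 \<in> A
     then min (int (min_subgroup_order TYPE('a)))
            (2 * int h * int m - int h ^ 2 - int h * int (card (A \<inter> uminus ` A)) + 1)
     else min (int (min_subgroup_order TYPE('a)))
            (2 * int h * int m - int h ^ 2 - int h * int (card (A \<inter> uminus ` A)) + int h + 1))"
proof -
  define B where "B = insert 0 (A \<union> uminus ` A)"
  have "card (A \<union> uminus ` A) + card (A \<inter> uminus ` A) = 2 * m"
    using card_Un_Int[of A "uminus ` A"] assms by (simp add: card_image)
  \<comment> \<open>Adjoining 0 enlarges the union exactly when \<open>A\<close> lacks it, which
    separates the two cases.\<close>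
  moreover have "0 \<in> A \<union> uminus ` A \<longleftrightarrow> 0 \<in> A" by force
  ultimately have card: "card B + card (A \<inter> uminus ` A) = 2 * m + (if 0 \<in> A then 0 else 1)"
    unfolding B_def by (simp add: card_insert_if)
  have "card A \<le> card B" by (rule card_mono) (auto simp: B_def)
  then have "h \<le> card B" using assms by simp
  then have "min (min_subgroup_order TYPE('a)) (1 + h * (card B - h)) \<le> card (restricted_sumset h B)"
    by (rule dias_da_silva_hamidoune)
  also have "\<dots> \<le> card (restricted_signed_sumset_upto h A)"
    using restricted_sumset_subset_signed unfolding B_def by (intro card_mono) auto
  finally have "min (int (min_subgroup_order TYPE('a))) (int (1 + h * (card B - h)))
      \<le> int (card (restricted_signed_sumset_upto h A))"
    by linarith
  moreover have "int (1 + h * (card B - h)) = 1 + int h * (int (card B) - int h)"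
    using \<open>h \<le> card B\<close> by (simp add: of_nat_diff)
  moreover have "int (card B) = 2 * int m + (if 0 \<in> A then 0 else 1) - int (card (A \<inter> uminus ` A))"
    using card by (auto split: if_splits)
  ultimately show ?thesis
    by (auto simp: algebra_simps power2_eq_square split: if_splits)
qed

end
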